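(* Let $u$ and $v$ be positive real numbers, and let $\mu(\pi)$ be the irrationality measure of $\pi$. Then for any $\epsilon>0$, $$\frac{1}{n^u\cdot |\sin(n)|^v} = O\left(\frac{1}{n^{u - (\mu(\pi)-1)\cdot v - \epsilon}}\right)$$ as $n\to\infty$ over the positive integers. Furthermore: (1) if $\mu(\pi)< 1+\frac{u}{v}$, then the sequence $\left(\frac{1}{n^u\cdot |\sin(n)|^v}\right)_{n\ge 1}$ converges to zero; (2) if $\mu(\pi) > 1+\frac{u}{v}$, then the sequence $\left(\frac{1}{n^u\cdot |\sin(n)|^v}\right)_{n\ge 1}$ diverges.
   Context: The irrationality measure $\mu(x)$ of a positive real number $x$ is the infimum of those $m$ for which the inequality $0 < \left|x - \frac{p}{q}\right| < \frac{1}{q^m}$ holds only for a finite number of pairs of co-prime positive integers $p$ and $q$. If no such $m$ exists, then $\mu(x) = +\infty$. It is a known result that $\mu(\pi)$ is finite (Mahler: $\mu(\pi)\le 30$; Salikhov: $\mu(\pi)\leq 7.6063\ldots$), so the exponent in the $O$-estimate is a real number. A sequence diverges if it does not converge to a finite limit. *)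

theory Defs
  imports "HOL-Analysis.Analysis" "HOL-Library.Landau_Symbols"
begin

text \<open>
  The infimum is taken in the extended reals, where the infimum of the empty set is
  \<open>\<infinity>\<close>; this is the convention for numbers admitting no such exponent \<open>m\<close>.
  As \<open>real_of_ereal \<infinity> = 0\<close>, taking the real value of the measure is meaningful only where it
  is finite; for \<open>pi\<close> this is a theorem of Mahler.
\<close>

definition irrationality_measure :: "real \<Rightarrow> ereal" where
  "irrationality_measure x =
     Inf (ereal ` {m :: real.
       finite {(p :: nat, q :: nat). p > 0 \<and> q > 0 \<and> coprime p q \<and>
         0 < \<bar>x - real p / real q\<bar> \<and> \<bar>x - real p / real q\<bar> < 1 / real q powr m}})"

text \<open>
  Only the values at \<open>n \<ge> 1\<close> matter; the term at \<open>n = 0\<close> is \<open>0\<close> because division by zero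
  yields zero.
\<close>

definition sin_seq :: "real \<Rightarrow> real \<Rightarrow> nat \<Rightarrow> real" where
  "sin_seq u v n = 1 / (real n powr u * \<bar>sin (real n)\<bar> powr v)"

end

theory Submission
  imports Defs "HOL-Complex_Analysis.Complex_Analysis"
begin

text \<open>
  If \<open>q\<close> is the integer nearest to \<open>N / pi\<close>, then \<open>\<bar>sin N\<bar>\<close> is comparable to
  \<open>\<bar>N - q * pi\<bar> = q * \<bar>pi - N / q\<bar>\<close>, so the size of \<open>sin_seq\<close> is governed by how well \<open>pi\<close>
  is approximated by fractions with numerator \<open>N\<close>.

  The \<open>O\<close>-estimate would be false if the measure of \<open>pi\<close> were infinite, so its finiteness is
  needed. Following Mahler, consider for fixed \<open>n\<close> and large \<open>m\<close> the function
  \<open>F w = m!^n * (m-d)! / ((\<Prod>l\<le>m. w - l)^n * (\<Prod>l=d..m. w - l))\<close> and the sum of the residues of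
  \<open>\<i>^k * exp (z * (w - k)) * F w\<close> at \<open>w = k\<close>, \<open>k \<le> m\<close>. It is a polynomial in \<open>z\<close> of degree at
  most \<open>n\<close> whose coefficients are exponentially bounded in \<open>m\<close> and have denominators dividing
  \<open>n! * D^n\<close>, where \<open>D \<le> 16^m\<close> is a common multiple of \<open>1, ..., m\<close>. At \<open>z = \<i> * pi / 2\<close> it is
  the integral of \<open>exp (z * w) * F w\<close> over a circle of radius \<open>33 * m\<close>, which is so small that it
  beats \<open>D^n\<close>. At \<open>z = \<i> * p / (2 * q)\<close> it is a Gaussian rational with denominator dividing
  \<open>n! * D^n * (2 * q)^n\<close>, and it is nonzero for a suitable \<open>d \<le> m\<close>. Choosing \<open>m\<close> proportional to
  \<open>ln q\<close> keeps the two values apart, and hence \<open>pi\<close> and \<open>p / q\<close>.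
\<close>

section \<open>Common multiples of initial segments\<close>

text \<open>From \<open>j * (p ^ e choose j) = p ^ e * (p ^ e - 1 choose (j - 1))\<close>: if
  \<open>p\<close> did not divide the binomial, all of \<open>p ^ e\<close> would have to divide
  \<open>j\<close>, which is too small.\<close>

lemma prime_dvd_choose_prime_power:
  fixes p :: nat
  assumes "prime p" "0 < j" "j < p ^ e"
  shows "p dvd (p ^ e choose j)"
proof (rule ccontr)
  assume "\<not> p dvd (p ^ e choose j)"
  then have "coprime (p ^ e) (p ^ e choose j)"
    using assms(1) by (simp add: prime_imp_coprime)
  moreover have "p ^ e dvd j * (p ^ e choose j)"
    using times_binomial_minus1_eq[OF assms(2)] by simp
  ultimately have "p ^ e dvd j"
    using coprime_dvd_mult_left_iff by blast
  with assms show False by (auto dest: dvd_imp_le)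
qed

text \<open>Vandermonde for the splitting \<open>2 * n = p ^ e + (2 * n - p ^ e)\<close>: the terms
  with \<open>0 < k\<close> are multiples of \<open>p\<close>, and the term \<open>k = 0\<close>
  vanishes because \<open>2 * n - p ^ e < n\<close>.\<close>

lemma prime_dvd_central_binomial:
  fixes p :: nat
  assumes "prime p" "n < p ^ e" "p ^ e \<le> 2 * n"
  shows "p dvd (2 * n choose n)"
proof -
  have eq: "(2 * n choose n) = (\<Sum>k\<le>n. (p ^ e choose k) * (2 * n - p ^ e choose (n - k)))"
    using vandermonde[of "p ^ e" "2 * n - p ^ e" n] assms(3) by simp
  have "p dvd (p ^ e choose k) * (2 * n - p ^ e choose (n - k))" if "k \<le> n" for k
  proof (cases "k = 0")
    case True
    have "2 * n - p ^ e < n" using assms by linarith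
    then show ?thesis using True by (simp add: binomial_eq_0)
  next
    case False
    then show ?thesis using prime_dvd_choose_prime_power[OF assms(1)] that assms(2) by simp
  qed
  then show ?thesis unfolding eq by (intro dvd_sum) simp
qed

text \<open>A prime power dividing \<open>k\<close> is either at most \<open>n\<close>, hence
  divides \<open>D\<close>, or exceeds \<open>n\<close> by less than one factor \<open>p\<close>:
  then \<open>p ^ (e - 1)\<close> divides \<open>D\<close> and the central binomial supplies the
  missing \<open>p\<close>.\<close>

lemma common_multiple_double:
  fixes n D :: nat
  assumes D: "\<And>k. k \<in> {1..n} \<Longrightarrow> k dvd D" "D > 0" and k: "k \<in> {1..2 * n}"
  shows "k dvd D * (2 * n choose n)"
proof (rule multiplicity_le_imp_dvd)
  show "k \<noteq> 0" using k by simp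
next
  fix p :: nat assume p: "prime p"
  define e where "e = multiplicity p k"
  have C: "(2 * n choose n) > 0" by simp
  have pe: "p ^ e dvd k" "p ^ e \<le> 2 * n"
    using multiplicity_dvd[of p k] k by (auto simp: e_def dest!: dvd_imp_le)
  have "p ^ e dvd D * (2 * n choose n)"
  proof (cases "p ^ e \<le> n")
    case True
    then have "p ^ e dvd D" using D(1)[of "p ^ e"] prime_gt_0_nat[OF p] by simp
    then show ?thesis by simp
  next
    case False
    then obtain e' where e': "e = Suc e'" using k by (cases e) auto
    have "2 * p ^ e' \<le> p ^ e" using prime_ge_2_nat[OF p] e' by simp
    then have "p ^ e' dvd D" using D(1)[of "p ^ e'"] prime_gt_0_nat[OF p] pe by simp
    moreover have "p dvd (2 * n choose n)"
      using prime_dvd_central_binomial[OF p _ pe(2)] False by simp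
    ultimately have "p ^ e' * p dvd D * (2 * n choose n)" by (rule mult_dvd_mono)
    then show ?thesis by (simp add: e' mult.commute)
  qed
  then show "multiplicity p k \<le> multiplicity p (D * (2 * n choose n))"
    using D(2) C p unfolding e_def
    by (intro multiplicity_geI) auto
qed

lemma common_multiple_power_two:
  "\<exists>D::nat. D > 0 \<and> D \<le> 4 ^ 2 ^ r \<and> (\<forall>k\<in>{1..2 ^ r}. k dvd D)"
proof (induction r)
  case 0
  show ?case by (rule exI[of _ 1]) auto
next
  case (Suc r)
  then obtain D :: nat where D: "D > 0" "D \<le> 4 ^ 2 ^ r" "\<forall>k\<in>{1..2 ^ r}. k dvd D" by blast
  let ?C = "2 * 2 ^ r choose 2 ^ r :: nat"
  have "?C \<le> 2 ^ (2 * 2 ^ r)" by (rule binomial_le_pow2)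
  also have "\<dots> = 4 ^ 2 ^ r" by (simp add: power_mult)
  finally have "D * ?C \<le> 4 ^ 2 ^ r * 4 ^ 2 ^ r" by (intro mult_mono D) auto
  also have "\<dots> = 4 ^ 2 ^ Suc r" by (simp add: mult_2 power_add)
  finally have "D * ?C \<le> 4 ^ 2 ^ Suc r" .
  moreover have "D * ?C > 0" using D(1) by simp
  moreover have "\<forall>k\<in>{1..2 ^ Suc r}. k dvd D * ?C"
    using common_multiple_double[of "2 ^ r" D] D by simp
  ultimately show ?case by blast
qed

text \<open>Repeated doubling gives base 4 at powers of two; rounding \<open>m\<close> up to a power
  of two at most \<open>2 * m\<close> squares the base.\<close>

lemma common_multiple_exponential_bound:
  fixes m :: nat
  assumes "m \<ge> 1"
  obtains D :: nat where "D > 0" "D \<le> 16 ^ m" "\<And>k. k \<in> {1..m} \<Longrightarrow> k dvd D"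
proof -
  obtain r where r: "2 ^ r \<le> m" "m < 2 ^ (r + 1)"
    using ex_power_ivl1[of 2 m] assms by auto
  obtain D :: nat where D: "D > 0" "D \<le> 4 ^ 2 ^ (r + 1)" "\<forall>k\<in>{1..2 ^ (r + 1)}. k dvd D"
    using common_multiple_power_two by blast
  note D(2)
  also have "(4::nat) ^ 2 ^ (r + 1) \<le> 4 ^ (2 * m)" using r(1) by (intro power_increasing) auto
  also have "(4::nat) ^ (2 * m) = 16 ^ m" by (simp add: power_mult)
  finally show ?thesis using that D r(2) by simp
qed

section \<open>Partial fractions with controlled denominators\<close>

text \<open>
  \<open>B\<close> bounds the sum of the absolute values of the coefficients. The denominator
  \<open>D ^ (t - s)\<close> allowed for a pole of order \<open>s\<close> is the invariant that survives multiplication by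
  \<open>1 / (w - j)\<close> when \<open>t\<close> grows by one. The order \<open>s = 0\<close> is admitted so that the constant
  \<open>1\<close> can start the induction.
\<close>

inductive partial_fraction :: "nat \<Rightarrow> nat \<Rightarrow> nat \<Rightarrow> real \<Rightarrow> (complex \<Rightarrow> complex) \<Rightarrow> bool" for m D t where
  pole: "k \<le> m \<Longrightarrow> s \<le> t \<Longrightarrow>
    partial_fraction m D t (\<bar>of_int a\<bar> / of_nat D ^ (t - s))
      (\<lambda>w. of_int a / (of_nat D ^ (t - s) * (w - of_nat k) ^ s))"
| add: "partial_fraction m D t B f \<Longrightarrow> partial_fraction m D t C g \<Longrightarrow> partial_fraction m D t (B + C) (\<lambda>w. f w + g w)"
| weaken: "partial_fraction m D t B f \<Longrightarrow> (\<And>w. w \<notin> of_nat ` {..m} \<Longrightarrow> g w = f w) \<Longrightarrow> B \<le> C \<Longrightarrow> partial_fraction m D t C g"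

text \<open>Since \<open>1 / e = e' / D ^ i\<close>, division by \<open>e\<close> keeps numerators
  integral at the price of \<open>i\<close> more factors \<open>D\<close>, while the size bound
  still improves by \<open>e\<close>.\<close>

lemma partial_fraction_divide:
  assumes "partial_fraction m D t B f" and e: "e * e' = int (D ^ i)" and D: "D > 0"
  shows "partial_fraction m D (t + i) (B / \<bar>of_int e\<bar>) (\<lambda>w. f w / of_int e)"
  using assms(1)
proof (induction rule: partial_fraction.induct)
  case (pole k s a)
  have e0: "e \<noteq> 0" "e' \<noteq> 0" using e D by (auto simp: zero_power)
  have ec: "(of_int e :: complex) * of_int e' = of_nat D ^ i"
    using arg_cong[OF e, of "of_int :: int \<Rightarrow> complex"] by simp
  have er: "(of_int e :: real) * of_int e' = of_nat D ^ i"
    using arg_cong[OF e, of "of_int :: int \<Rightarrow> real"] by simp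
  have er': "\<bar>of_int e :: real\<bar> * \<bar>of_int e'\<bar> = of_nat D ^ i"
    by (simp flip: abs_mult add: er)
  have ts: "t + i - s = (t - s) + i" using pole by simp
  have "partial_fraction m D (t + i) (\<bar>of_int (a * e')\<bar> / of_nat D ^ (t + i - s))
      (\<lambda>w. of_int (a * e') / (of_nat D ^ (t + i - s) * (w - of_nat k) ^ s))"
    using pole by (intro partial_fraction.pole) auto
  then show ?case
  proof (rule partial_fraction.weaken)
    fix w :: complex
    show "of_int a / (of_nat D ^ (t - s) * (w - of_nat k) ^ s) / of_int e =
      of_int (a * e') / (of_nat D ^ (t + i - s) * (w - of_nat k) ^ s)"
      using e0 unfolding ts power_add ec[symmetric] by simp
  next
    show "\<bar>of_int (a * e')\<bar> / of_nat D ^ (t + i - s) \<le> \<bar>real_of_int a\<bar> / of_nat D ^ (t - s) / \<bar>of_int e\<bar>"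
      using e0 unfolding ts power_add er'[symmetric] by (simp add: abs_mult)
  qed
next
  case (add B f C g)
  show ?case
    by (rule partial_fraction.weaken[OF partial_fraction.add[OF add.IH]]) (auto simp: add_divide_distrib)
next
  case (weaken B f g C)
  show ?case
    by (rule partial_fraction.weaken[OF weaken.IH]) (use weaken in \<open>auto intro!: divide_right_mono\<close>)
qed

lemma partial_fraction_of_int_mult:
  assumes "partial_fraction m D t B f"
  shows "partial_fraction m D t (\<bar>of_int c\<bar> * B) (\<lambda>w. of_int c * f w)"
  using assms
proof (induction rule: partial_fraction.induct)
  case (pole k s a)
  show ?case
    by (rule partial_fraction.weaken[OF partial_fraction.pole[OF pole, of D "c * a"]]) (auto simp: abs_mult)
next
  case (add B f C g)
  show ?case
    by (rule partial_fraction.weaken[OF partial_fraction.add[OF add.IH]]) (auto simp: distrib_left)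
next
  case (weaken B f g C)
  show ?case
    by (rule partial_fraction.weaken[OF weaken.IH]) (use weaken in \<open>auto intro!: mult_left_mono\<close>)
qed

lemma partial_fraction_uminus: "partial_fraction m D t B f \<Longrightarrow> partial_fraction m D t B (\<lambda>w. - f w)"
  using partial_fraction_of_int_mult[of m D t B f "-1"] by simp

lemma partial_fraction_simple_pole:
  assumes "k \<le> m" "s \<le> t" "D > 0"
  shows "partial_fraction m D t (1 / of_nat D ^ (t - s)) (\<lambda>w. 1 / (of_nat D ^ (t - s) * (w - of_nat k) ^ s))"
  using partial_fraction.pole[OF assms(1,2), of D 1] by simp

text \<open>The only denominators created by separating poles are differences of nodes, so a common
  multiple of \<open>1, ..., m\<close> clears each of them.\<close>

lemma int_diff_dvd_common_multiple:
  assumes D: "\<And>i. i \<in> {1..m} \<Longrightarrow> i dvd D" and "k \<le> m" "j \<le> m" "k \<noteq> j"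
  shows "int k - int j dvd int D"
proof -
  have "int (if k \<le> j then j - k else k - j) dvd int D"
    unfolding of_nat_dvd_iff using assms(2-4) by (intro D) auto
  then have "\<bar>int k - int j\<bar> dvd int D"
    by (rule back_subst[of "\<lambda>x. x dvd _"]) (auto simp: of_nat_diff)
  then show ?thesis by simp
qed

text \<open>
  Here \<open>t = s + 1\<close>, and the step is
  \<open>X (s + 1) = (1 / (w - k) ^ (s + 1) - X s) / (k - j)\<close> for the function \<open>X s\<close> in question.
\<close>

lemma partial_fraction_two_poles:
  assumes D: "\<And>i. i \<in> {1..m} \<Longrightarrow> i dvd D" "D > 0" and kj: "k \<le> m" "j \<le> m" "k \<noteq> j"
  shows "partial_fraction m D (Suc s) (real (Suc s)) (\<lambda>w. 1 / ((w - of_nat k) ^ s * (w - of_nat j)))"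
proof (induction s)
  case 0
  show ?case using partial_fraction_simple_pole[OF kj(2) order.refl D(2), of 1] by simp
next
  case (Suc s)
  define e where "e = int k - int j"
  obtain e' where e': "e * e' = int (D ^ 1)"
    using int_diff_dvd_common_multiple[OF D(1) kj] unfolding e_def power_one_right by (metis dvdE)
  have "\<bar>e\<bar> \<ge> 1" using kj by (simp add: e_def)
  then have e1: "\<bar>real_of_int e\<bar> \<ge> 1" by linarith
  have "partial_fraction m D (Suc s) 1 (\<lambda>w. 1 / (w - of_nat k) ^ Suc s)"
    using partial_fraction_simple_pole[OF kj(1) order.refl D(2), of "Suc s"] by simp
  from partial_fraction_divide[OF partial_fraction.add[OF this partial_fraction_uminus[OF Suc]] e' D(2)]
  have "partial_fraction m D (Suc (Suc s)) ((1 + real (Suc s)) / \<bar>real_of_int e\<bar>)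
    (\<lambda>w. (1 / (w - of_nat k) ^ Suc s + - (1 / ((w - of_nat k) ^ s * (w - of_nat j)))) / of_int e)"
    by simp
  then show ?case
  proof (rule partial_fraction.weaken)
    fix w :: complex assume "w \<notin> of_nat ` {..m}"
    then have "w - of_nat k \<noteq> 0" "w - of_nat j \<noteq> 0" using kj by auto
    moreover have "(of_nat k - of_nat j :: complex) \<noteq> 0" using kj by simp
    ultimately show "1 / ((w - of_nat k) ^ Suc s * (w - of_nat j)) =
      (1 / (w - of_nat k) ^ Suc s + - (1 / ((w - of_nat k) ^ s * (w - of_nat j)))) / of_int e"
      unfolding e_def by (simp add: divide_simps)
  next
    have "(1 + real (Suc s)) / \<bar>real_of_int e\<bar> \<le> (1 + real (Suc s)) / 1"
      using e1 by (intro divide_left_mono) auto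
    then show "(1 + real (Suc s)) / \<bar>real_of_int e\<bar> \<le> real (Suc (Suc s))" by simp
  qed
qed

text \<open>At the same node the order of the pole rises along with \<open>t\<close>, leaving
  \<open>t - s\<close> unchanged. At another node the two-pole expansion applies, and the old factor
  \<open>D ^ (t - s)\<close> is divided out afterwards.\<close>

lemma partial_fraction_mult_pole:
  assumes D: "\<And>i. i \<in> {1..m} \<Longrightarrow> i dvd D" "D > 0" and j: "j \<le> m" and f: "partial_fraction m D t B f"
  shows "partial_fraction m D (Suc t) (real (Suc t) * B) (\<lambda>w. f w / (w - of_nat j))"
  using f
proof (induction rule: partial_fraction.induct)
  case (pole k s a)
  let ?A = "\<bar>of_int a\<bar> / real D ^ (t - s)"
  show ?case
  proof (cases "k = j")
    case True
    have "partial_fraction m D (Suc t) (\<bar>of_int a\<bar> / of_nat D ^ (Suc t - Suc s))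
      (\<lambda>w. of_int a / (of_nat D ^ (Suc t - Suc s) * (w - of_nat k) ^ Suc s))"
      using pole by (intro partial_fraction.pole) auto
    then show ?thesis
    proof (rule partial_fraction.weaken)
      have "1 * ?A \<le> real (Suc t) * ?A" by (intro mult_right_mono) auto
      then show "\<bar>real_of_int a\<bar> / real D ^ (Suc t - Suc s) \<le> real (Suc t) * ?A" by simp
    qed (auto simp: True field_simps)
  next
    case False
    have "partial_fraction m D (Suc s) (real (Suc s)) (\<lambda>w. 1 / ((w - of_nat k) ^ s * (w - of_nat j)))"
      by (rule partial_fraction_two_poles[OF D pole(1) j False])
    from partial_fraction_divide[OF this, of "int (D ^ (t - s))" 1 "t - s"] D(2) pole
    have "partial_fraction m D (Suc t) (real (Suc s) / real D ^ (t - s))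
       (\<lambda>w. 1 / ((w - of_nat k) ^ s * (w - of_nat j)) / of_nat D ^ (t - s))" 
      by simp
    from partial_fraction_of_int_mult[OF this, of a] show ?thesis
    proof (rule partial_fraction.weaken)
      have "?A * real (Suc s) \<le> ?A * real (Suc t)" using pole by (intro mult_left_mono) auto
      then show "\<bar>real_of_int a\<bar> * (real (Suc s) / real D ^ (t - s)) \<le> real (Suc t) * ?A"
        by (simp add: mult.commute)
    qed (auto simp: field_simps)
  qed
next
  case (add B f C g)
  show ?case
    by (rule partial_fraction.weaken[OF partial_fraction.add[OF add.IH]]) (auto simp: add_divide_distrib distrib_left)
next
  case (weaken B f g C)
  show ?case
    by (rule partial_fraction.weaken[OF weaken.IH]) (use weaken in \<open>auto intro!: mult_left_mono\<close>)
qed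


text \<open>
  Multiplying by \<open>r! / \<Prod>(w - l)\<close> costs only one unit of \<open>t\<close>, not \<open>r + 1\<close>: this function is a
  combination of the \<open>1 / (w - l)\<close> with binomial coefficients, by Newton's difference recursion.
\<close>

lemma partial_fraction_mult_block:
  assumes D: "\<And>i. i \<in> {1..m} \<Longrightarrow> i dvd D" "D > 0" and f: "partial_fraction m D t B f" and "d + r \<le> m"
  shows "partial_fraction m D (Suc t) (2 ^ r * (real (Suc t) * B))
    (\<lambda>w. f w * (fact r / (\<Prod>l=d..d + r. w - of_nat l)))"
  using assms(4)
proof (induction r arbitrary: d)
  case 0
  then show ?case using partial_fraction_mult_pole[OF D _ f, of d] by simp
next
  case (Suc r)
  have "partial_fraction m D (Suc t) (2 ^ r * (real (Suc t) * B) + 2 ^ r * (real (Suc t) * B))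
    (\<lambda>w. f w * (fact r / (\<Prod>l=Suc d..Suc d + r. w - of_nat l))
       + - (f w * (fact r / (\<Prod>l=d..d + r. w - of_nat l))))"
    using Suc.prems by (intro partial_fraction.add partial_fraction_uminus Suc.IH) auto
  then show ?case
  proof (rule partial_fraction.weaken)
    fix w :: complex assume w: "w \<notin> of_nat ` {..m}"
    define P where "P = (\<Prod>l=Suc d..d + r. w - of_nat l)"
    have "P \<noteq> 0" using w Suc.prems by (auto simp: P_def)
    moreover have "w - of_nat d \<noteq> 0" "w - of_nat (Suc (d + r)) \<noteq> 0"
      using w Suc.prems by (auto simp del: of_nat_Suc)
    moreover have "(\<Prod>l=d..d + r. w - of_nat l) = (w - of_nat d) * P"
      unfolding P_def by (rule prod.atLeast_Suc_atMost) simp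
    moreover have "(\<Prod>l=Suc d..Suc d + r. w - of_nat l) = P * (w - of_nat (Suc (d + r)))"
      by (simp add: P_def del: of_nat_Suc)
    moreover have "(\<Prod>l=d..d + Suc r. w - of_nat l) = (w - of_nat d) * P * (w - of_nat (Suc (d + r)))"
      using prod.atLeast_Suc_atMost[of d "d + r" "\<lambda>l. w - of_nat l"] by (simp add: P_def del: of_nat_Suc)
    ultimately show "f w * (fact (Suc r) / (\<Prod>l=d..d + Suc r. w - of_nat l)) =
      f w * (fact r / (\<Prod>l=Suc d..Suc d + r. w - of_nat l))
       + - (f w * (fact r / (\<Prod>l=d..d + r. w - of_nat l)))"
      by (simp add: divide_simps) (simp add: algebra_simps)
  qed simp
qed

text \<open>The factorials make every block a binomial combination of simple poles. The last block
  starts at \<open>d\<close>, so the poles have order \<open>n\<close> below \<open>d\<close> and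
  \<open>n + 1\<close> from \<open>d\<close> on; varying \<open>d\<close> yields enough kernels for
  non-vanishing.\<close>

definition pade_kernel :: "nat \<Rightarrow> nat \<Rightarrow> nat \<Rightarrow> complex \<Rightarrow> complex" where
  "pade_kernel m n d w = (fact m / (\<Prod>l=0..m. w - of_nat l)) ^ n * (fact (m - d) / (\<Prod>l=d..m. w - of_nat l))"

text \<open>There are \<open>n + 1\<close> blocks, each raising \<open>t\<close> by one and the
  bound by at most \<open>2 ^ m * t\<close>. Thus the power of \<open>D\<close> depends on
  \<open>n\<close> alone, not on the number of poles.\<close>

lemma partial_fraction_pade_kernel:
  assumes D: "\<And>i. i \<in> {1..m} \<Longrightarrow> i dvd D" "D > 0" and "d \<le> m"
  shows "partial_fraction m D (Suc n) (2 ^ (m * Suc n) * fact (Suc n)) (pade_kernel m n d)"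
proof -
  have G: "partial_fraction m D n (2 ^ (m * n) * fact n) (\<lambda>w. (fact m / (\<Prod>l=0..m. w - of_nat l)) ^ n)" for n
  proof (induction n)
    case 0
    show ?case using partial_fraction.pole[of 0 m 0 0 D 1] by simp
  next
    case (Suc n)
    show ?case
      by (rule partial_fraction.weaken[OF partial_fraction_mult_block[OF D Suc, of 0 m]]) (auto simp: power_add mult_ac)
  qed
  have "2 ^ (m - d) * (real (Suc n) * (2 ^ (m * n) * fact n)) \<le> 2 ^ m * (real (Suc n) * (2 ^ (m * n) * fact n))"
    by (intro mult_right_mono power_increasing) auto
  also have "\<dots> = 2 ^ (m * Suc n) * fact (Suc n)" by (simp add: power_add mult_ac)
  finally show ?thesis
    using assms(3) by (intro partial_fraction.weaken[OF partial_fraction_mult_block[OF D G, of d "m - d"]]) (auto simp: pade_kernel_def)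
qed

section \<open>Hermite-Pade forms as contour integrals\<close>

text \<open>The residue of \<open>exp (z * (w - l)) / (w - l) ^ s\<close> at \<open>w = l\<close>;
  the value \<open>0\<close> at \<open>s = 0\<close> reflects the absence of a pole.\<close>

definition exp_coeff :: "complex \<Rightarrow> nat \<Rightarrow> complex" where
  "exp_coeff z s = (if s = 0 then 0 else z ^ (s - 1) / fact (s - 1))"

lemma higher_deriv_exp_mult: "(deriv ^^ k) (\<lambda>w. exp (z * w)) = (\<lambda>w. z ^ k * exp (z * w :: complex))"
proof (induction k)
  case (Suc k)
  have "deriv (\<lambda>w. z ^ k * exp (z * w)) w = z ^ Suc k * exp (z * w)" for w
    by (rule DERIV_imp_deriv) (auto intro!: derivative_eq_intros)
  then show ?case by (simp add: Suc fun_eq_iff)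
qed simp

lemma has_contour_integral_exp_pole:
  assumes "norm (l - c) < r"
  shows "((\<lambda>w. exp (z * w) / (w - l) ^ s) has_contour_integral
    2 * pi * \<i> * exp_coeff z s * exp (z * l)) (circlepath c r)"
proof (cases s)
  case 0
  have "((\<lambda>w. exp (z * w)) has_contour_integral 0) (circlepath c r)"
    by (rule Cauchy_theorem_convex_simple[of _ UNIV]) (auto intro!: holomorphic_intros)
  then show ?thesis by (simp add: 0 exp_coeff_def)
next
  case (Suc k)
  have "((\<lambda>w. exp (z * w) / (w - l) ^ Suc k) has_contour_integral
      (2 * pi * \<i>) / fact k * (deriv ^^ k) (\<lambda>w. exp (z * w)) l) (circlepath c r)"
    using assms by (intro Cauchy_has_contour_integral_higher_derivative_circlepath)
      (auto intro!: continuous_intros holomorphic_intros simp: dist_norm norm_minus_commute)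
  then show ?thesis unfolding higher_deriv_exp_mult by (simp add: Suc exp_coeff_def mult_ac)
qed

lemma norm_of_nat_diff_ge_1: "k \<noteq> l \<Longrightarrow> norm (of_nat k - of_nat l :: complex) \<ge> 1"
proof -
  assume "k \<noteq> l"
  have "norm (of_nat k - of_nat l :: complex) = \<bar>real_of_int (int k - int l)\<bar>"
    by (metis norm_of_int of_int_diff of_int_of_nat_eq)
  with \<open>k \<noteq> l\<close> show ?thesis by linarith
qed

text \<open>Distinct nodes are at distance at least 1, so the unit disc around \<open>k\<close> is
  free of the pole and Cauchy's theorem applies there.\<close>

lemma has_contour_integral_exp_other_pole:
  assumes "k \<noteq> l"
  shows "((\<lambda>w. exp (z * w) / (w - of_nat l) ^ s) has_contour_integral 0) (circlepath (of_nat k) (1 / 2))"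
proof (rule Cauchy_theorem_convex_simple[of _ "ball (of_nat k) 1"])
  have "w \<noteq> of_nat l" if "w \<in> ball (of_nat k) 1" for w :: complex
    using norm_of_nat_diff_ge_1[OF assms] that by (auto simp: dist_norm)
  then show "(\<lambda>w. exp (z * w) / (w - of_nat l) ^ s) holomorphic_on ball (of_nat k) 1"
    by (auto intro!: holomorphic_intros)
qed auto

text \<open>
  The sum of the residues of \<open>\<i> ^ k * exp (z * (w - k)) * f w\<close> at \<open>w = k\<close>. For a partial fraction
  \<open>f\<close> it is a polynomial in \<open>z\<close>. At \<open>z = \<i> * pi / 2\<close> the weights cancel and the sum is a single
  integral over a large circle.
\<close>

definition node_integral :: "nat \<Rightarrow> complex \<Rightarrow> (complex \<Rightarrow> complex) \<Rightarrow> complex" where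
  "node_integral m z f = (\<Sum>k\<le>m. \<i> ^ k * exp (- (z * of_nat k)) / (2 * pi * \<i>) *
     contour_integral (circlepath (of_nat k) (1 / 2)) (\<lambda>w. exp (z * w) * f w))"

lemma circlepath_avoids_nat: "path_image (circlepath (of_nat k) (1 / 2)) \<subseteq> - (of_nat ` {..m})"
proof -
  have "norm (of_nat k - of_nat l :: complex) \<noteq> 1 / 2" for l
    using norm_of_nat_diff_ge_1[of k l] by (cases "k = l") auto
  then show ?thesis by (auto simp: sphere_def dist_norm)
qed

lemma contour_integrable_exp_mult:
  assumes "f holomorphic_on - (of_nat ` {..m})"
  shows "(\<lambda>w. exp (z * w) * f w) contour_integrable_on circlepath (of_nat k) (1 / 2)"
  by (intro contour_integrable_continuous_circlepath continuous_intros
      holomorphic_on_imp_continuous_on holomorphic_on_subset[OF assms circlepath_avoids_nat])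

lemma node_integral_add:
  assumes "f holomorphic_on - (of_nat ` {..m})" "g holomorphic_on - (of_nat ` {..m})"
  shows "node_integral m z (\<lambda>w. f w + g w) = node_integral m z f + node_integral m z g"
  by (simp add: node_integral_def distrib_left sum.distrib contour_integral_add
      contour_integrable_exp_mult[OF assms(1)] contour_integrable_exp_mult[OF assms(2)])

lemma node_integral_cong:
  assumes "\<And>w. w \<notin> of_nat ` {..m} \<Longrightarrow> f w = g w"
  shows "node_integral m z f = node_integral m z g"
proof -
  have "contour_integral (circlepath (of_nat k) (1 / 2)) (\<lambda>w. exp (z * w) * f w) =
    contour_integral (circlepath (of_nat k) (1 / 2)) (\<lambda>w. exp (z * w) * g w)" for k
    by (rule contour_integral_eq) (use circlepath_avoids_nat[of k m] assms in auto)
  then show ?thesis by (simp add: node_integral_def)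
qed

lemma node_integral_cmult:
  assumes "f holomorphic_on - (of_nat ` {..m})"
  shows "node_integral m z (\<lambda>w. c * f w) = c * node_integral m z f"
proof -
  have "contour_integral (circlepath (of_nat k) (1 / 2)) (\<lambda>w. exp (z * w) * (c * f w)) =
    c * contour_integral (circlepath (of_nat k) (1 / 2)) (\<lambda>w. exp (z * w) * f w)" for k
    by (subst contour_integral_lmul[OF contour_integrable_exp_mult[OF assms], symmetric])
       (simp add: mult_ac)
  then show ?thesis by (simp add: node_integral_def sum_distrib_left mult_ac)
qed

text \<open>Only the circle around \<open>k\<close> contributes, and its weight
  \<open>exp (- (z * k))\<close> cancels the exponential in the residue. This is why the forms are
  polynomials in \<open>z\<close>.\<close>

lemma node_integral_pole:
  assumes "k \<le> m"
  shows "node_integral m z (\<lambda>w. 1 / (w - of_nat k) ^ s) = \<i> ^ k * exp_coeff z s"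
proof -
  have "contour_integral (circlepath (of_nat j) (1 / 2)) (\<lambda>w. exp (z * w) * (1 / (w - of_nat k) ^ s))
    = (if j = k then 2 * pi * \<i> * exp_coeff z s * exp (z * of_nat k) else 0)" for j
    using has_contour_integral_exp_pole[of "of_nat k" "of_nat k" "1 / 2" z s]
      has_contour_integral_exp_other_pole[of j k z s]
    by (auto intro!: contour_integral_unique)
  then have "node_integral m z (\<lambda>w. 1 / (w - of_nat k) ^ s) = (\<Sum>j\<le>m. if j = k then
    \<i> ^ k * exp (- (z * of_nat k)) / (2 * pi * \<i>) * (2 * pi * \<i> * exp_coeff z s * exp (z * of_nat k)) else 0)"
    unfolding node_integral_def by (intro sum.cong) auto
  also have "\<dots> = \<i> ^ k * exp_coeff z s"
    using assms by (simp add: exp_minus field_simps)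
  finally show ?thesis .
qed

lemma holomorphic_nat_pole:
  "k \<le> m \<Longrightarrow> (\<lambda>w. 1 / (w - of_nat k) ^ s) holomorphic_on - (of_nat ` {..m} :: complex set)"
  by (auto intro!: holomorphic_intros)

lemma partial_fraction_holomorphic: "partial_fraction m D t B f \<Longrightarrow> f holomorphic_on - (of_nat ` {..m})"
proof (induction rule: partial_fraction.induct)
  case (pole k s a)
  have "(\<lambda>w. of_int a / of_nat D ^ (t - s) * (1 / (w - of_nat k) ^ s)) holomorphic_on - (of_nat ` {..m})"
    using pole by (intro holomorphic_intros holomorphic_nat_pole)
  then show ?case by simp
next
  case (weaken B f g C)
  then show ?case by (auto intro: holomorphic_transform)
qed (auto intro!: holomorphic_intros)

lemma node_integral_scaled_pole:
  assumes "k \<le> m"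
  shows "node_integral m z (\<lambda>w. of_int a / (of_nat D ^ u * (w - of_nat k) ^ s))
    = of_int a / of_nat D ^ u * (\<i> ^ k * exp_coeff z s)"
  using node_integral_cmult[OF holomorphic_nat_pole[OF assms], of z "of_int a / of_nat D ^ u" s]
  by (simp add: node_integral_pole[OF assms])

section \<open>Integrality and size\<close>

definition gaussian_int :: "complex set" where
  "gaussian_int = {of_int x + \<i> * of_int y | x y. True}"

lemma gaussian_int_add: "a \<in> gaussian_int \<Longrightarrow> b \<in> gaussian_int \<Longrightarrow> a + b \<in> gaussian_int"
proof -
  assume "a \<in> gaussian_int" "b \<in> gaussian_int"
  then obtain x y x' y' where "a = of_int x + \<i> * of_int y" "b = of_int x' + \<i> * of_int y'"
    by (auto simp: gaussian_int_def)
  then have "a + b = of_int (x + x') + \<i> * of_int (y + y')" by (simp add: algebra_simps)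
  then show ?thesis unfolding gaussian_int_def by blast
qed

lemma gaussian_int_i_mult: "a \<in> gaussian_int \<Longrightarrow> \<i> * a \<in> gaussian_int"
proof -
  assume "a \<in> gaussian_int"
  then obtain x y where "a = of_int x + \<i> * of_int y" by (auto simp: gaussian_int_def)
  then have "\<i> * a = of_int (- y) + \<i> * of_int x" by (simp add: algebra_simps)
  then show ?thesis unfolding gaussian_int_def by blast
qed

lemma gaussian_int_of_int: "of_int x \<in> gaussian_int"
  unfolding gaussian_int_def by (rule CollectI, rule exI[of _ x], rule exI[of _ 0]) simp

lemma gaussian_int_i_power: "\<i> ^ k * of_int x \<in> gaussian_int"
  by (induction k) (auto simp: gaussian_int_of_int mult.assoc intro: gaussian_int_i_mult)

lemma norm_gaussian_int_ge_1:
  assumes "a \<in> gaussian_int" "a \<noteq> 0"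
  shows "norm a \<ge> 1"
proof -
  obtain x y where a: "a = of_int x + \<i> * of_int y" using assms by (auto simp: gaussian_int_def)
  have "x \<noteq> 0 \<or> y \<noteq> 0" using assms(2) a by auto
  moreover have "\<bar>Re a\<bar> = of_int \<bar>x\<bar>" "\<bar>Im a\<bar> = of_int \<bar>y\<bar>" by (simp_all add: a)
  ultimately have "\<bar>Re a\<bar> \<ge> 1 \<or> \<bar>Im a\<bar> \<ge> 1" by linarith
  then show ?thesis using abs_Re_le_cmod[of a] abs_Im_le_cmod[of a] by linarith
qed

text \<open>A pole of order \<open>u + 1\<close> has denominators \<open>D ^ (n - u)\<close>,
  \<open>u!\<close> and \<open>(2 * q) ^ u\<close> with \<open>u \<le> n\<close>, each dividing the
  corresponding factor of the multiplier.\<close>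

lemma partial_fraction_node_integral_gaussian_int:
  assumes "partial_fraction m D (Suc n) B f" "D > 0" "q > 0"
  shows "of_nat (D ^ n * fact n * (2 * q) ^ n) * node_integral m (\<i> * of_nat p / of_nat (2 * q)) f \<in> gaussian_int"
  using assms(1)
proof (induction rule: partial_fraction.induct)
  case (pole k s a)
  show ?case
  proof (cases s)
    case 0
    then show ?thesis
      using gaussian_int_of_int[of 0] unfolding node_integral_scaled_pole[OF pole(1)]
      by (simp add: exp_coeff_def)
  next
    case (Suc u)
    then have u: "u \<le> n" using pole by simp
    obtain c :: nat where c: "fact n = fact u * c" using fact_dvd[OF u] by (metis dvdE)
    have n: "n = (n - u) + u" using u by simp
    let ?q = "2 * of_nat q :: complex"
    have "of_nat (D ^ n * fact n * (2 * q) ^ n) *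
      node_integral m (\<i> * of_nat p / of_nat (2 * q)) (\<lambda>w. of_int a / (of_nat D ^ (Suc n - s) * (w - of_nat k) ^ s))
      = of_nat D ^ n * of_nat (fact n) * ?q ^ n *
        (of_int a / of_nat D ^ (n - u) * (\<i> ^ k * ((\<i> * of_nat p / ?q) ^ u / fact u)))"
      unfolding node_integral_scaled_pole[OF pole(1)] by (simp add: Suc exp_coeff_def)
    also have "of_nat D ^ n = (of_nat D ^ (n - u) * of_nat D ^ u :: complex)"
      by (metis n power_add)
    also have "?q ^ n = ?q ^ (n - u) * ?q ^ u"
      by (metis n power_add)
    also have "of_nat (fact n) = (fact u * of_nat c :: complex)"
      unfolding c by simp
    also have "of_nat D ^ (n - u) * of_nat D ^ u * (fact u * of_nat c) * (?q ^ (n - u) * ?q ^ u) *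
        (of_int a / of_nat D ^ (n - u) * (\<i> ^ k * ((\<i> * of_nat p / ?q) ^ u / fact u)))
       = \<i> ^ (k + u) * of_int (a * int (D ^ u * c * (2 * q) ^ (n - u) * p ^ u))"
      using assms(2,3) by (simp add: power_mult_distrib power_divide power_add field_simps)
    finally show ?thesis by (simp only: gaussian_int_i_power)
  qed
next
  case (add B f C g)
  then show ?case
    by (simp only: node_integral_add[OF add(1,2)[THEN partial_fraction_holomorphic]] distrib_left gaussian_int_add)
next
  case (weaken B f g C)
  then show ?case
    by (subst node_integral_cong[of m g f]) auto
qed

section \<open>Lipschitz dependence of the forms on \<open>z\<close>\<close>

lemma norm_power_diff_bound:
  fixes z w :: complex
  assumes "norm z \<le> r" "norm w \<le> r" "r \<ge> 1"
  shows "norm (z ^ u - w ^ u) \<le> real u * r ^ u * norm (z - w)"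
proof (induction u)
  case (Suc u)
  have "z ^ Suc u - w ^ Suc u = z * (z ^ u - w ^ u) + (z - w) * w ^ u" by (simp add: algebra_simps)
  also have "norm \<dots> \<le> norm z * norm (z ^ u - w ^ u) + norm (z - w) * norm w ^ u"
    by (rule order.trans[OF norm_triangle_ineq]) (simp add: norm_mult norm_power)
  also have "\<dots> \<le> r * (real u * r ^ u * norm (z - w)) + norm (z - w) * r ^ Suc u"
  proof (intro add_mono mult_mono Suc assms)
    have "norm w ^ u \<le> r ^ u" using assms by (intro power_mono) auto
    also have "\<dots> \<le> r ^ Suc u" using assms by (intro power_increasing) auto
    finally show "norm w ^ u \<le> r ^ Suc u" .
  qed (use assms in auto)
  also have "\<dots> = real (Suc u) * r ^ Suc u * norm (z - w)" by (simp add: algebra_simps)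
  finally show ?case .
qed simp

text \<open>The factor \<open>u\<close> from differentiating \<open>z ^ u\<close> is absorbed by
  \<open>u!\<close>.\<close>

lemma exp_coeff_diff_bound:
  assumes "norm z \<le> r" "norm w \<le> r" "r \<ge> 1" "s \<le> t"
  shows "norm (exp_coeff z s - exp_coeff w s) \<le> r ^ t * norm (z - w)"
proof (cases s)
  case 0
  then show ?thesis using assms by (simp add: exp_coeff_def)
next
  case (Suc u)
  have "norm (exp_coeff z s - exp_coeff w s) = norm (z ^ u - w ^ u) / fact u"
    by (simp add: Suc exp_coeff_def norm_divide norm_fact flip: diff_divide_distrib)
  also have "\<dots> \<le> (real u * r ^ u * norm (z - w)) / fact u"
    by (intro divide_right_mono norm_power_diff_bound assms) auto
  also have "\<dots> = (real u / fact u) * (r ^ u * norm (z - w))" by simp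
  also have "\<dots> \<le> 1 * (r ^ t * norm (z - w))"
  proof (intro mult_mono power_increasing)
    have "real u \<le> fact u" by (metis fact_ge_self of_nat_fact of_nat_le_iff)
    then show "real u / fact u \<le> 1" by simp
  qed (use assms Suc in auto)
  finally show ?thesis by simp
qed

lemma partial_fraction_node_integral_diff_bound:
  assumes "partial_fraction m D t B f" "norm z \<le> r" "norm w \<le> r" "r \<ge> 1"
  shows "norm (node_integral m z f - node_integral m w f) \<le> B * (r ^ t * norm (z - w))"
  using assms(1)
proof (induction rule: partial_fraction.induct)
  case (pole k s a)
  have "norm (node_integral m z (\<lambda>w. of_int a / (of_nat D ^ (t - s) * (w - of_nat k) ^ s))
     - node_integral m w (\<lambda>w. of_int a / (of_nat D ^ (t - s) * (w - of_nat k) ^ s)))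
    = norm (of_int a / of_nat D ^ (t - s) * (\<i> ^ k * (exp_coeff z s - exp_coeff w s)))"
    unfolding node_integral_scaled_pole[OF pole(1)] by (simp only: right_diff_distrib)
  also have "\<dots> = \<bar>of_int a\<bar> / real D ^ (t - s) * norm (exp_coeff z s - exp_coeff w s)"
    by (simp only: norm_mult norm_divide norm_power) simp
  also have "\<dots> \<le> \<bar>of_int a\<bar> / real D ^ (t - s) * (r ^ t * norm (z - w))"
    by (intro mult_left_mono exp_coeff_diff_bound assms pole) auto
  finally show ?case .
next
  case (add B f C g)
  have "norm (node_integral m z (\<lambda>w. f w + g w) - node_integral m w (\<lambda>w. f w + g w))
    = norm ((node_integral m z f - node_integral m w f) + (node_integral m z g - node_integral m w g))"
    by (simp only: node_integral_add[OF add(1,2)[THEN partial_fraction_holomorphic]] add_diff_add)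
  also have "\<dots> \<le> B * (r ^ t * norm (z - w)) + C * (r ^ t * norm (z - w))"
    by (rule norm_triangle_le) (intro add_mono add)
  finally show ?case by (simp add: distrib_right)
next
  case (weaken B f g C)
  have "B * (r ^ t * norm (z - w)) \<le> C * (r ^ t * norm (z - w))"
    using weaken assms by (intro mult_right_mono) auto
  then show ?case
    using weaken node_integral_cong[of m g f] by auto
qed

section \<open>Smallness of the forms at \<open>\<i> * pi / 2\<close>\<close>

lemma exp_half_pi_i_mult_nat: "exp (\<i> * pi / 2 * of_nat k) = \<i> ^ k"
  by (metis exp_of_nat2_mult exp_pi_i' cis_conv_exp cis_pi_half mult.commute times_divide_eq_right of_real_divide of_real_numeral)

text \<open>This is where pi enters: \<open>exp (\<i> * pi / 2 * k) = \<i> ^ k\<close>, so the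
  unweighted residues inside the big circle already equal the weighted ones of
  \<open>node_integral\<close>.\<close>

lemma partial_fraction_has_contour_integral_big_circle:
  assumes "partial_fraction m D t B f" "real m < R"
  shows "((\<lambda>w. exp (\<i> * pi / 2 * w) * f w) has_contour_integral
    2 * pi * \<i> * node_integral m (\<i> * pi / 2) f) (circlepath 0 R)"
  using assms(1)
proof (induction rule: partial_fraction.induct)
  case (pole k s a)
  let ?c = "of_int a / of_nat D ^ (t - s) :: complex"
  have "norm (of_nat k - 0 :: complex) < R" using pole assms(2) by simp
  from has_contour_integral_lmul[OF has_contour_integral_exp_pole[OF this, of "\<i> * pi / 2" s], of ?c]
  show ?case
    unfolding node_integral_scaled_pole[OF pole(1)] exp_half_pi_i_mult_nat
    by (simp add: mult_ac)
next
  case (add B f C g)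
  from has_contour_integral_add[OF add.IH] show ?case
    by (simp add: node_integral_add[OF add(1,2)[THEN partial_fraction_holomorphic]] distrib_left)
next
  case (weaken B f g C)
  have "exp (\<i> * pi / 2 * w) * f w = exp (\<i> * pi / 2 * w) * g w"
    if "w \<in> path_image (circlepath 0 R)" for w
  proof -
    have "norm w = R" using that assms(2) by (auto simp: path_image_circlepath)
    then have "w \<notin> of_nat ` {..m}" using assms(2) by auto
    then show ?thesis using weaken by simp
  qed
  then show ?case
    using has_contour_integral_eq[OF weaken.IH] node_integral_cong[of m g f] weaken by auto
qed

text \<open>On the circle of radius \<open>33 * m\<close> every node is at distance at least
  \<open>32 * m\<close>; the \<open>r + 1\<close> factors beat \<open>r! \<le> m ^ r\<close> with
  one factor to spare.\<close>

lemma block_norm_bound: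
  fixes w :: complex
  assumes "norm w = 33 * real m" "m \<ge> 1" "d + r \<le> m"
  shows "norm (fact r / (\<Prod>l=d..d + r. w - of_nat l)) \<le> (1 / 32) ^ r / (32 * real m)"
proof -
  have "32 * real m \<le> norm (w - of_nat l)" if "l \<in> {d..d + r}" for l
    using norm_triangle_ineq2[of w "of_nat l"] assms that by simp
  then have "(\<Prod>l=d..d + r. 32 * real m) \<le> (\<Prod>l=d..d + r. norm (w - of_nat l))"
    by (intro prod_mono) auto
  then have P: "(32 * real m) ^ Suc r \<le> norm (\<Prod>l=d..d + r. w - of_nat l)"
    by (simp add: prod_norm)
  have "fact r \<le> real r ^ r" by (metis fact_le_power order.refl of_nat_power)
  also have "\<dots> \<le> real m ^ r" using assms by (intro power_mono) auto
  finally have F: "fact r \<le> real m ^ r" .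
  have "norm (fact r / (\<Prod>l=d..d + r. w - of_nat l)) \<le> real m ^ r / (32 * real m) ^ Suc r"
    unfolding norm_divide norm_fact using F P assms by (intro frac_le) auto
  also have "\<dots> = (1 / 32) ^ r / (32 * real m)"
    using assms by (simp add: field_simps power_mult_distrib)
  finally show ?thesis .
qed

lemma pade_kernel_norm_bound:
  assumes "norm w = 33 * real m" "m \<ge> 1" "d \<le> m"
  shows "norm (pade_kernel m n d w) \<le> (1 / 32) ^ (m * n) / (32 * real m)"
proof -
  have "norm (fact m / (\<Prod>l=0..m. w - of_nat l)) \<le> (1 / 32) ^ m / (32 * real m)"
    using block_norm_bound[of w m 0 m] assms by simp
  also have "\<dots> \<le> (1 / 32) ^ m / 1" using assms by (intro divide_left_mono) auto
  finally have 1: "norm (fact m / (\<Prod>l=0..m. w - of_nat l)) ^ n \<le> ((1 / 32) ^ m) ^ n"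
    by (intro power_mono) auto
  have "norm (fact (m - d) / (\<Prod>l=d..m. w - of_nat l)) \<le> (1 / 32) ^ (m - d) / (32 * real m)"
    using block_norm_bound[of w m d "m - d"] assms by simp
  also have "\<dots> \<le> 1 / (32 * real m)" by (intro divide_right_mono power_le_one) auto
  finally have 2: "norm (fact (m - d) / (\<Prod>l=d..m. w - of_nat l)) \<le> 1 / (32 * real m)" .
  have "norm (pade_kernel m n d w) \<le> ((1 / 32) ^ m) ^ n * (1 / (32 * real m))"
    unfolding pade_kernel_def norm_mult norm_power by (intro mult_mono 1 2) auto
  then show ?thesis by (simp add: power_mult)
qed

text \<open>The length of the circle against \<open>1 / (32 * m)\<close> leaves only
  \<open>33 / 32\<close>, and \<open>pi / 2 < 2\<close> gives the exponent
  \<open>66 * m\<close>.\<close>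

lemma node_integral_pade_kernel_half_pi_bound:
  assumes "m \<ge> 1" "d \<le> m"
  shows "norm (node_integral m (\<i> * pi / 2) (pade_kernel m n d)) \<le> 2 * exp (66 * real m) / 32 ^ (m * n)"
proof -
  let ?R = "33 * real m" and ?J = "node_integral m (\<i> * pi / 2) (pade_kernel m n d)"
  obtain D :: nat where D: "D > 0" "\<And>k. k \<in> {1..m} \<Longrightarrow> k dvd D"
    using common_multiple_exponential_bound[OF assms(1)] by metis
  have *: "((\<lambda>w. exp (\<i> * pi / 2 * w) * pade_kernel m n d w) has_contour_integral 2 * pi * \<i> * ?J)
    (circlepath 0 ?R)"
    using assms by (intro partial_fraction_has_contour_integral_big_circle[OF partial_fraction_pade_kernel[OF D(2,1) assms(2)]]) auto
  have "norm (2 * pi * \<i> * ?J) \<le> (exp (2 * ?R) * ((1 / 32) ^ (m * n) / (32 * real m))) * (2 * pi * ?R)"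
  proof (rule has_contour_integral_bound_circlepath[OF *])
    fix w :: complex assume "norm (w - 0) = ?R"
    then have w: "norm w = 33 * real m" by simp
    have "norm (exp (\<i> * pi / 2 * w)) \<le> exp (norm (\<i> * pi / 2 * w))"
      by (rule norm_exp)
    also have "norm (\<i> * pi / 2 * w) = pi / 2 * ?R"
      by (simp add: norm_mult w)
    also have "exp (pi / 2 * ?R) \<le> exp (2 * ?R)"
      using pi_less_4 by (auto intro!: mult_right_mono)
    finally show "norm (exp (\<i> * pi / 2 * w) * pade_kernel m n d w) \<le> exp (2 * ?R) * ((1 / 32) ^ (m * n) / (32 * real m))"
      unfolding norm_mult by (intro mult_mono pade_kernel_norm_bound w assms) auto
  qed (use assms in auto)
  also have "\<dots> = 2 * pi * (33 / 32 * exp (66 * real m) / 32 ^ (m * n))"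
    using assms by (simp add: field_simps)
  finally have "2 * pi * norm ?J \<le> 2 * pi * (33 / 32 * exp (66 * real m) / 32 ^ (m * n))"
    by (simp only: norm_mult) simp
  then have "norm ?J \<le> 33 / 32 * exp (66 * real m) / 32 ^ (m * n)"
    by (subst (asm) mult_le_cancel_left_pos) auto
  also have "\<dots> \<le> 2 * exp (66 * real m) / 32 ^ (m * n)" by (intro divide_right_mono) auto
  finally show ?thesis .
qed

section \<open>Non-vanishing\<close>

text \<open>Polynomials with one of each degree form a basis: subtracting a multiple of the one of
  equal degree removes the leading term.\<close>

lemma poly_functional_eq_zero:
  fixes L :: "complex poly \<Rightarrow> complex"
  assumes "\<And>p q. L (p + q) = L p + L q" "\<And>c p. L (smult c p) = c * L p"
    and ex: "\<And>d. \<exists>p. p \<noteq> 0 \<and> degree p = d \<and> L p = 0"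
  shows "L p = 0"
proof (induction "degree p" arbitrary: p rule: less_induct)
  case less
  have L0: "L 0 = 0" using assms(2)[of 0 0] by simp
  show ?case
  proof (cases "p = 0")
    case False
    obtain g where g: "g \<noteq> 0" "degree g = degree p" "L g = 0" using ex by blast
    define c where "c = lead_coeff p / lead_coeff g"
    define h where "h = p - smult c g"
    have p: "p = h + smult c g" by (simp add: h_def)
    have "coeff g (degree p) \<noteq> 0" using g by (metis leading_coeff_neq_0)
    then have "coeff h (degree p) = 0" using g by (simp add: h_def c_def)
    moreover have "degree h \<le> degree p" unfolding h_def
      by (rule degree_diff_le) (use g in \<open>auto intro: order.trans[OF degree_smult_le]\<close>)
    ultimately have "h = 0 \<or> degree h < degree p"
      by (metis eq_zero_or_degree_less)
    then have "L h = 0" using less L0 by auto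
    then have "L (h + smult c g) = 0" by (simp only: assms(1,2) g(3)) simp
    then show ?thesis by (simp only: p[symmetric])
  qed (simp add: L0)
qed

lemma degree_prod_linear: "degree (\<Prod>l\<in>A. [:- of_nat l, 1:] :: complex poly) = card A"
  by (cases "finite A") (subst degree_prod_sum_eq, auto)

text \<open>The integrand, multiplied by \<open>exp (z * w)\<close>, is the derivative of \<open>exp (z * w) * H / V ^ n\<close>.\<close>

lemma node_integral_exact_derivative:
  fixes H V :: "complex poly"
  assumes V: "\<And>w. w \<notin> of_nat ` {..m} \<Longrightarrow> poly V w \<noteq> 0"
  shows "node_integral m z (\<lambda>w. poly (pderiv H * V - of_nat n * (H * pderiv V) + smult z (H * V)) w
    / poly V w ^ Suc n) = 0"
proof -
  have "((\<lambda>w. exp (z * w) * (poly (pderiv H * V - of_nat n * (H * pderiv V) + smult z (H * V)) w / poly V w ^ Suc n))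
    has_contour_integral 0) (circlepath (of_nat k) (1 / 2))" for k
  proof (rule Cauchy_theorem_primitive[where S = "- (of_nat ` {..m})" and
      f = "\<lambda>w. exp (z * w) * (poly H w / poly V w ^ n)"])
    fix w :: complex assume "w \<in> - (of_nat ` {..m})"
    then have V0: "poly V w \<noteq> 0" using V by auto
    show "((\<lambda>w. exp (z * w) * (poly H w / poly V w ^ n)) has_field_derivative
      exp (z * w) * (poly (pderiv H * V - of_nat n * (H * pderiv V) + smult z (H * V)) w / poly V w ^ Suc n))
        (at w within - (of_nat ` {..m}))"
    proof (cases n)
      case 0
      then show ?thesis using V0 by (auto intro!: derivative_eq_intros simp: field_simps)
    next
      case (Suc j)
      define U where "U = (\<lambda>w. poly V w ^ n)"
      have U: "(U has_field_derivative of_nat n * (poly (pderiv V) w * poly V w ^ j))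
        (at w within - (of_nat ` {..m}))"
        using DERIV_power[OF DERIV_subset[OF poly_DERIV[of V w] subset_UNIV], of n] Suc
        unfolding U_def by simp
      have Uw: "U w = poly V w * poly V w ^ j" by (simp add: U_def Suc)
      have "((\<lambda>w. exp (z * w) * (poly H w / U w)) has_field_derivative
        exp (z * w) * z * (poly H w / U w) + exp (z * w) * ((poly (pderiv H) w * U w
          - poly H w * (of_nat n * (poly (pderiv V) w * poly V w ^ j))) / (U w * U w)))
        (at w within - (of_nat ` {..m}))"
        by (rule derivative_eq_intros U refl | use V0 in \<open>simp add: U_def\<close>)+
      also have "exp (z * w) * z * (poly H w / U w) + exp (z * w) * ((poly (pderiv H) w * U w
          - poly H w * (of_nat n * (poly (pderiv V) w * poly V w ^ j))) / (U w * U w)) =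
        exp (z * w) * (poly (pderiv H * V - of_nat n * (H * pderiv V) + smult z (H * V)) w / poly V w ^ Suc n)"
      proof -
        have "x * z * (H / (V * P)) + x * ((H' * (V * P) - H * (N * (V' * P))) / ((V * P) * (V * P)))
          = x * ((H' * V - N * (H * V') + z * (H * V)) / (V * (V * P)))"
          if "V \<noteq> 0" "P \<noteq> 0" for x z H V P H' N V' :: complex
          using that by (simp add: field_simps)
        then show ?thesis using V0 by (simp add: Uw Suc of_nat_poly del: of_nat_Suc)
      qed
      finally show ?thesis unfolding U_def .
    qed
  qed (use circlepath_avoids_nat in auto)
  from contour_integral_unique[OF this] show ?thesis
    unfolding node_integral_def by (simp only: mult_zero_right sum.neutral_const)
qed

text \<open>Differentiation lowers degrees, so for \<open>z \<noteq> 0\<close> only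
  \<open>z * H * V\<close> reaches the top degree.\<close>

lemma degree_exact_derivative:
  fixes H V :: "complex poly"
  assumes "z \<noteq> 0" "H \<noteq> 0" "degree V > 0"
  shows "degree (pderiv H * V - of_nat n * (H * pderiv V) + smult z (H * V)) = degree H + degree V"
proof -
  have V0: "V \<noteq> 0" using assms by auto
  have "degree (pderiv H * V) < degree H + degree V"
  proof (cases "degree H = 0")
    case True
    then have "pderiv H = 0" by (simp add: pderiv_eq_0_iff)
    then show ?thesis using assms by simp
  next
    case False
    then show ?thesis using degree_mult_le[of "pderiv H" V] by (simp add: degree_pderiv)
  qed
  moreover have "degree (of_nat n * (H * pderiv V)) < degree H + degree V"
    using degree_mult_le[of "of_nat n" "H * pderiv V"] degree_mult_le[of H "pderiv V"] assms
    by (simp add: degree_pderiv)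
  ultimately have "degree (pderiv H * V - of_nat n * (H * pderiv V)) < degree H + degree V"
    by (rule degree_diff_less)
  moreover have "degree (smult z (H * V)) = degree H + degree V"
    using assms V0 by (simp add: degree_mult_eq)
  ultimately show ?thesis by (metis degree_add_eq_right)
qed

text \<open>
  If all the forms vanished, so would the functional \<open>g \<mapsto> node_integral m z (g / V ^ (n + 1))\<close> on a
  polynomial of every degree: the numerators of the kernels for degrees up to \<open>m\<close>, exact
  derivatives for the others. But its value at \<open>g = V ^ (n + 1) / w\<close> is \<open>1\<close>.
\<close>

lemma node_integral_pade_kernel_nonzero:
  assumes "z \<noteq> 0"
  obtains d where "d \<le> m" "node_integral m z (pade_kernel m n d) \<noteq> 0"
proof (rule ccontr)
  assume "\<not> thesis"
  then have vanish: "node_integral m z (pade_kernel m n d) = 0" if "d \<le> m" for d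
    using that \<open>\<And>d. d \<le> m \<Longrightarrow> node_integral m z (pade_kernel m n d) \<noteq> 0 \<Longrightarrow> thesis\<close> by blast
  let ?lin = "\<lambda>l. [:- of_nat l, 1:] :: complex poly"
  define V where "V = (\<Prod>l=0..m. ?lin l)"
  have polyV: "poly V w = (\<Prod>l=0..m. w - of_nat l)" for w
    by (simp add: V_def poly_prod)
  have V0: "poly V w \<noteq> 0" if "w \<notin> of_nat ` {..m}" for w
    using that by (auto simp: polyV)
  define L where "L = (\<lambda>g. node_integral m z (\<lambda>w. poly g w / poly V w ^ Suc n))"
  have hol: "(\<lambda>w. poly g w / poly V w ^ Suc n) holomorphic_on - (of_nat ` {..m})" for g
    using V0 by (intro holomorphic_intros) auto
  have L_add: "L (p + q) = L p + L q" for p q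
    using node_integral_add[OF hol[of p] hol[of q], of z] by (simp only: L_def poly_add add_divide_distrib)
  have L_smult: "L (smult c p) = c * L p" for c p
    using node_integral_cmult[OF hol[of p], of z c] by (simp only: L_def poly_smult times_divide_eq_right)
  have "\<exists>p. p \<noteq> 0 \<and> degree p = d \<and> L p = 0" for d
  proof (cases "d \<le> m")
    case True
    \<comment> \<open>\<open>g\<close> collects the linear factors missing from the last block,
      which makes the kernel a constant times \<open>g / V ^ (n + 1)\<close>.\<close>
    define g where "g = (\<Prod>l<d. ?lin l)"
    define c :: complex where "c = fact m ^ n * fact (m - d)"
    have split: "poly V w = poly g w * (\<Prod>l=d..m. w - of_nat l)" for w
    proof -
      have "{0..m} = {..<d} \<union> {d..m}" "{..<d} \<inter> {d..m} = {}" using True by auto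
      then show ?thesis by (simp add: polyV g_def poly_prod prod.union_disjoint)
    qed
    have "pade_kernel m n d w = c * (poly g w / poly V w ^ Suc n)" if "w \<notin> of_nat ` {..m}" for w
    proof -
      have "poly V w \<noteq> 0" by (rule V0[OF that])
      then have nz: "poly g w \<noteq> 0" "(\<Prod>l=d..m. w - of_nat l) \<noteq> 0" unfolding split by auto
      have "fact (m - d) / (\<Prod>l=d..m. w - of_nat l) = fact (m - d) * poly g w / poly V w"
        unfolding split using nz by simp
      then show ?thesis
        unfolding pade_kernel_def polyV[symmetric] c_def by (simp add: power_divide mult_ac)
    qed
    then have "node_integral m z (pade_kernel m n d) = node_integral m z (\<lambda>w. c * (poly g w / poly V w ^ Suc n))"
      by (rule node_integral_cong)
    then have "c * L g = 0" unfolding L_def node_integral_cmult[OF hol] vanish[OF True] by simp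
    moreover have "c \<noteq> 0" by (simp add: c_def)
    moreover have "degree g = d" "g \<noteq> 0" unfolding g_def by (auto simp: degree_prod_linear)
    ultimately show ?thesis by auto
  next
    case False
    \<comment> \<open>\<open>V\<close> has degree \<open>m + 1\<close>, so this choice gives the
      exact derivative degree \<open>d\<close>.\<close>
    define H where "H = monom (1::complex) (d - Suc m)"
    let ?E = "pderiv H * V - of_nat n * (H * pderiv V) + smult z (H * V)"
    have dV: "degree V = Suc m" by (simp add: V_def degree_prod_linear)
    have "degree ?E = degree H + degree V"
      by (rule degree_exact_derivative[OF assms]) (auto simp: H_def dV)
    then have "degree ?E = d" using False by (simp add: H_def degree_monom_eq dV)
    moreover from this have "?E \<noteq> 0" using False by auto
    moreover have "L ?E = 0" unfolding L_def by (rule node_integral_exact_derivative[OF V0])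
    ultimately show ?thesis by blast
  qed
  then have "L (V ^ n * (\<Prod>l=1..m. ?lin l)) = 0"
    by (rule poly_functional_eq_zero[OF L_add L_smult])
  moreover have "poly (V ^ n * (\<Prod>l=1..m. ?lin l)) w / poly V w ^ Suc n = 1 / (w - of_nat 0) ^ 1"
    if "w \<notin> of_nat ` {..m}" for w
  proof -
    have "poly V w = w * poly (\<Prod>l=1..m. ?lin l) w"
      by (simp add: polyV poly_prod prod.atLeast_Suc_atMost)
    then show ?thesis using V0[OF that] by (simp add: poly_power)
  qed
  then have "L (V ^ n * (\<Prod>l=1..m. ?lin l)) = node_integral m z (\<lambda>w. 1 / (w - of_nat 0) ^ 1)"
    unfolding L_def by (rule node_integral_cong)
  ultimately show False using node_integral_pole[of 0 m z 1] by (simp add: exp_coeff_def)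
qed

section \<open>An irrationality measure for pi\<close>

lemma exp_66_mult_le: "exp (66 * real m) \<le> 2 ^ (105 * m)"
proof -
  have "exp (66::real) = exp 1 ^ 66" by (simp flip: exp_of_nat_mult)
  also have "\<dots> \<le> 3 ^ 66" by (intro power_mono exp_le) auto
  also have "\<dots> \<le> 2 ^ 105" by simp
  finally have "exp (66::real) ^ m \<le> (2 ^ 105) ^ m" by (intro power_mono) auto
  moreover have "exp (66 * real m) = exp 66 ^ m" by (simp add: mult.commute flip: exp_of_nat_mult)
  ultimately show ?thesis by (simp only: power_mult)
qed

text \<open>After clearing denominators by \<open>N\<close>, the form \<open>X\<close> at the
  rational point is a nonzero Gaussian integer, while the form \<open>Y\<close> at
  \<open>\<i> * pi / 2\<close> has norm at most 1/2. The Lipschitz bound turns the remaining gap of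
  1/2 into a lower bound for the distance of the two points.\<close>

lemma pi_minus_rational_bound_aux:
  fixes p q m n :: nat
  assumes "p > 0" "q > 0" "m \<ge> 1" and close: "\<bar>pi - real p / real q\<bar> \<le> 1"
    and m: "4 * (fact n * (2 * real q) ^ n) * exp (66 * real m) \<le> 2 ^ (m * n)"
  shows "1 \<le> (2 ^ m) ^ (5 * n + 1) * (fact n * 2 ^ n * fact (Suc n) * 3 ^ Suc n) * real q ^ n
    * \<bar>pi - real p / real q\<bar>"
proof -
  obtain D :: nat where D: "D > 0" "D \<le> 16 ^ m" "\<And>k. k \<in> {1..m} \<Longrightarrow> k dvd D"
    using common_multiple_exponential_bound[OF assms(3)] by metis
  define z0 where "z0 = \<i> * of_nat p / of_nat (2 * q)"
  have "z0 \<noteq> 0" using assms by (simp add: z0_def)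
  then obtain d where d: "d \<le> m" "node_integral m z0 (pade_kernel m n d) \<noteq> 0"
    by (rule node_integral_pade_kernel_nonzero)
  define X Y where "X = node_integral m z0 (pade_kernel m n d)"
    and "Y = node_integral m (\<i> * pi / 2) (pade_kernel m n d)"
  define N where "N = D ^ n * fact n * (2 * q) ^ n"
  note pf = partial_fraction_pade_kernel[OF D(3,1) d(1), of n]
  have "N > 0" using assms D by (simp add: N_def)
  have "of_nat N * X \<in> gaussian_int"
    unfolding N_def X_def z0_def by (rule partial_fraction_node_integral_gaussian_int[OF pf]) (use assms D in auto)
  then have "norm (of_nat N * X) \<ge> 1"
    by (rule norm_gaussian_int_ge_1) (use \<open>N > 0\<close> d in \<open>auto simp: X_def\<close>)
  then have NX: "1 \<le> real N * norm X" by (simp add: norm_mult)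
  have "real D \<le> 16 ^ m" using D(2) by (metis of_nat_le_iff of_nat_numeral of_nat_power)
  then have "real D ^ n \<le> (16 ^ m) ^ n" by (rule power_mono) simp
  then have N: "real N \<le> (16 ^ m) ^ n * (fact n * (2 * real q) ^ n)"
    by (simp add: N_def mult_right_mono mult.assoc)
  have "real N * norm Y \<le> (16 ^ m) ^ n * (fact n * (2 * real q) ^ n) * (2 * exp (66 * real m) / 32 ^ (m * n))"
    unfolding Y_def by (intro mult_mono N node_integral_pade_kernel_half_pi_bound assms d) auto
  also have "\<dots> = 4 * (fact n * (2 * real q) ^ n) * exp (66 * real m) / 2 ^ (m * n) / 2"
  proof -
    \<comment> \<open>Of the decay \<open>32 ^ (m * n)\<close>, the part \<open>16 ^ (m * n)\<close>
      cancels the bound on \<open>D ^ n\<close>; the rest is what the hypothesis on \<open>m\<close>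
      weighs against the other factors.\<close>
    have "(32::real) ^ (m * n) = 2 ^ (m * n) * (16 ^ m) ^ n"
      by (simp flip: power_mult_distrib power_mult)
    then show ?thesis by simp
  qed
  also have "\<dots> \<le> 1 / 2" using m by (simp only: divide_le_eq_1_pos divide_right_mono zero_less_power zero_less_numeral)
  finally have NY: "real N * norm Y \<le> 1 / 2" .
  have close': "norm z0 \<le> 3" "norm (\<i> * complex_of_real pi / 2) \<le> 3"
    using close pi_less_4 assms by (auto simp: z0_def norm_mult norm_divide abs_le_iff)
  have "z0 - \<i> * pi / 2 = \<i> * of_real (real p / real q - pi) / 2"
    by (simp add: z0_def diff_divide_distrib right_diff_distrib)
  also have "norm \<dots> = \<bar>pi - real p / real q\<bar> / 2"
    unfolding norm_divide norm_mult norm_of_real by simp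
  finally have dz: "norm (z0 - \<i> * pi / 2) = \<bar>pi - real p / real q\<bar> / 2" .
  have XY: "norm (X - Y) \<le> 2 ^ (m * Suc n) * fact (Suc n) * (3 ^ Suc n * (\<bar>pi - real p / real q\<bar> / 2))"
    unfolding X_def Y_def dz[symmetric] using partial_fraction_node_integral_diff_bound[OF pf close'] by simp
  have "norm X \<le> norm (X - Y) + norm Y" using norm_triangle_sub[of X Y] by simp
  then have "real N * norm X \<le> real N * norm (X - Y) + real N * norm Y"
    by (metis distrib_left mult_left_mono of_nat_0_le_iff)
  with NX NY have "1 / 2 \<le> real N * norm (X - Y)" by linarith
  also have "\<dots> \<le> ((16 ^ m) ^ n * (fact n * (2 * real q) ^ n)) *
     (2 ^ (m * Suc n) * fact (Suc n) * (3 ^ Suc n * (\<bar>pi - real p / real q\<bar> / 2)))"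
    by (intro mult_mono N XY) auto
  finally have "1 \<le> ((16 ^ m) ^ n * 2 ^ (m * Suc n)) * (fact n * 2 ^ n * fact (Suc n) * 3 ^ Suc n) * real q ^ n
    * \<bar>pi - real p / real q\<bar>"
    by (simp add: power_mult_distrib mult_ac)
  also have "(16 ^ m) ^ n * 2 ^ (m * Suc n) = ((2 ^ m) ^ (5 * n + 1) :: real)"
  proof -
    have "(16::real) = 2 ^ 4" by simp
    then show ?thesis by (simp only: power_mult[symmetric] power_add[symmetric]) (simp add: algebra_simps)
  qed
  finally show ?thesis .
qed

lemma pi_minus_rational_lower_bound:
  obtains c :: real and M :: nat where "c > 0"
    "\<And>p q :: nat. p > 0 \<Longrightarrow> q > 0 \<Longrightarrow> c / real q ^ M \<le> \<bar>pi - real p / real q\<bar>"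
proof -
  \<comment> \<open>The decay of the forms is \<open>exp (66 * m) / 32 ^ (m * n)\<close> against denominators up to
    \<open>16 ^ (m * n)\<close>; as \<open>exp 66 < 2 ^ 105\<close>, \<open>n = 106\<close> suffices. An \<open>obtain\<close> keeps the
    simplifier from evaluating \<open>fact n\<close>.\<close>
  obtain n :: nat where n: "n = 106" by simp
  \<comment> \<open>\<open>K * q ^ n\<close> equals \<open>4 * n! * (2 * q) ^ n\<close>, the factor
    that \<open>2 ^ (m * n)\<close> has to beat besides the exponential.\<close>
  define K :: nat where "K = 4 * fact n * 2 ^ n"
  define C where "C = (2 * real K) ^ (5 * n + 1) * (fact n * 2 ^ n * fact (Suc n) * 3 ^ Suc n)"
  define M where "M = n * (5 * n + 1) + n"
  have K: "K > 0" by (simp add: K_def)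
  have C: "C > 0" using K by (simp add: C_def)
  have main: "min 1 (1 / C) / real q ^ M \<le> \<bar>pi - real p / real q\<bar>" if pq: "p > 0" "q > 0" for p q :: nat
  proof -
    let ?\<delta> = "\<bar>pi - real p / real q\<bar>"
    have q: "real q \<ge> 1" using pq by simp
    then have qM: "real q ^ M \<ge> 1" by simp
    show ?thesis
    proof (cases "?\<delta> \<le> 1")
      case False
      have "min 1 (1 / C) / real q ^ M \<le> 1 / real q ^ M"
        using qM by (intro divide_right_mono) auto
      also have "\<dots> \<le> 1" using qM by (subst divide_le_eq_1_pos) (use pq in auto)
      finally show ?thesis using False by simp
    next
      case True
      \<comment> \<open>With \<open>m = r + 1\<close>, \<open>2 ^ m\<close> lies between
        \<open>K * q ^ n\<close> and twice that: the lower bound makes the form at pi small enough,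
        the upper one turns powers of \<open>2 ^ m\<close> into powers of \<open>q\<close>.\<close>
      obtain r where r: "2 ^ r \<le> K * q ^ n" "K * q ^ n < 2 ^ (r + 1)"
        using ex_power_ivl1[of 2 "K * q ^ n"] K pq by auto
      define m where "m = r + 1"
      have m1: "m \<ge> 1" by (simp add: m_def)
      have "2 ^ m \<le> 2 * (K * q ^ n)" using r(1) by (simp add: m_def)
      then have mle: "2 ^ m \<le> 2 * real K * real q ^ n"
        unfolding of_nat_le_iff[where 'a = real, symmetric] by (simp add: mult.assoc)
      have "K * q ^ n \<le> 2 ^ m" using r(2) by (simp add: m_def)
      then have mge: "real K * real q ^ n \<le> 2 ^ m"
        unfolding of_nat_le_iff[where 'a = real, symmetric] by simp
      have "4 * (fact n * (2 * real q) ^ n) * exp (66 * real m) = (real K * real q ^ n) * exp (66 * real m)"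
        by (simp add: K_def power_mult_distrib)
      also have "\<dots> \<le> 2 ^ m * 2 ^ (105 * m)" by (intro mult_mono mge exp_66_mult_le) auto
      also have "\<dots> = 2 ^ (m * n)" unfolding n by (simp add: mult.commute flip: power_add)
      finally have "1 \<le> (2 ^ m) ^ (5 * n + 1) * (fact n * 2 ^ n * fact (Suc n) * 3 ^ Suc n) * real q ^ n * ?\<delta>"
        by (rule pi_minus_rational_bound_aux[OF pq m1 True])
      also have "\<dots> \<le> (2 * real K * real q ^ n) ^ (5 * n + 1) * (fact n * 2 ^ n * fact (Suc n) * 3 ^ Suc n) * real q ^ n * ?\<delta>"
        by (intro mult_right_mono power_mono mle) auto
      also have "\<dots> = C * real q ^ M * ?\<delta>"
      proof -
        have "(2 * real K * real q ^ n) ^ (5 * n + 1) = (2 * real K) ^ (5 * n + 1) * real q ^ (n * (5 * n + 1))"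
          by (simp only: power_mult_distrib power_mult)
        then show ?thesis by (simp only: C_def M_def power_add mult_ac)
      qed
      finally have "1 \<le> ?\<delta> * (C * real q ^ M)" by (simp only: mult_ac)
      moreover have "0 < C * real q ^ M" using C q by (intro mult_pos_pos zero_less_power) auto
      ultimately have "1 / C / real q ^ M \<le> ?\<delta>"
        by (simp only: pos_divide_le_eq divide_divide_eq_left)
      moreover have "min 1 (1 / C) / real q ^ M \<le> 1 / C / real q ^ M"
        using qM by (intro divide_right_mono) auto
      ultimately show ?thesis by linarith
    qed
  qed
  show ?thesis by (rule that[of "min 1 (1 / C)" M]) (use C main in auto)
qed

section \<open>The sine sequence\<close>

definition good_approximations :: "real \<Rightarrow> real \<Rightarrow> (nat \<times> nat) set" where
  "good_approximations x m = {(p, q). p > 0 \<and> q > 0 \<and> coprime p q \<and>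
     0 < \<bar>x - real p / real q\<bar> \<and> \<bar>x - real p / real q\<bar> < 1 / real q powr m}"

lemma irrationality_measure_alt:
  "irrationality_measure x = Inf (ereal ` {m. finite (good_approximations x m)})"
  by (simp add: irrationality_measure_def good_approximations_def)

lemma pi_neq_rational:
  fixes p q :: nat
  assumes "p > 0" "q > 0"
  shows "pi \<noteq> real p / real q"
proof -
  obtain c :: real and M :: nat where c: "c > 0"
    "\<And>p q :: nat. p > 0 \<Longrightarrow> q > 0 \<Longrightarrow> c / real q ^ M \<le> \<bar>pi - real p / real q\<bar>"
    using pi_minus_rational_lower_bound by blast
  have "0 < c / real q ^ M" using c(1) assms by simp
  also have "\<dots> \<le> \<bar>pi - real p / real q\<bar>" by (rule c(2)[OF assms])
  finally show ?thesis by simp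
qed

lemma close_to_pi_imp_less:
  fixes p q :: nat
  assumes "q > 0" "\<bar>pi - real p / real q\<bar> < 1"
  shows "p < 5 * q" "q < p"
proof -
  have "real p / real q < 5" "1 < real p / real q" using assms(2) pi_less_4 pi_gt3 by linarith+
  then have "real p < real (5 * q)" "real q < real p" using assms(1) by (simp_all add: field_simps)
  then show "p < 5 * q" "q < p" by linarith+
qed

text \<open>With exponent \<open>M + 1\<close>, the bound \<open>c / q ^ M\<close> forces
  \<open>q < 1 / c\<close>, and closeness to pi then bounds \<open>p\<close>.\<close>

lemma finite_good_approximations_pi: "\<exists>m. finite (good_approximations pi m)"
proof -
  obtain c :: real and M :: nat where c: "c > 0"
    "\<And>p q :: nat. p > 0 \<Longrightarrow> q > 0 \<Longrightarrow> c / real q ^ M \<le> \<bar>pi - real p / real q\<bar>"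
    using pi_minus_rational_lower_bound by blast
  define b where "b = nat \<lceil>1 / c\<rceil>"
  have "good_approximations pi (real (Suc M)) \<subseteq> {..5 * b} \<times> {..b}"
  proof (clarify, unfold good_approximations_def, clarify)
    fix p q :: nat
    assume pq: "p > 0" "q > 0" and d: "\<bar>pi - real p / real q\<bar> < 1 / real q powr real (Suc M)"
    have q: "real q \<ge> 1" using pq by simp
    have d': "\<bar>pi - real p / real q\<bar> < 1 / real q ^ Suc M"
      using d pq by (simp only: powr_realpow of_nat_0_less_iff)
    have "c / real q ^ M < 1 / real q ^ Suc M" using c(2)[OF pq] d' by linarith
    then have "c * real q < 1" using q by (simp add: field_simps)
    then have "real q < 1 / c" using c(1) by (simp add: field_simps)
    then have "q \<le> b" unfolding b_def by linarith
    moreover have "1 \<le> real q ^ Suc M" using q by (rule one_le_power)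
    then have "1 / real q ^ Suc M \<le> 1" by (simp only: divide_le_eq_1) auto
    then have "p < 5 * q" using d' by (intro close_to_pi_imp_less(1)[OF pq(2)]) linarith
    ultimately show "p \<in> {..5 * b} \<and> q \<in> {..b}" by auto
  qed
  then show ?thesis by (meson finite_SigmaI finite_atMost finite_subset)
qed

text \<open>For \<open>m \<le> 0\<close> the tolerance is at least 1, and the reduced fractions
  \<open>3 + 1 / q\<close> all lie that close to pi. This bounds the infimum from below and makes
  \<open>q powr m\<close> increasing in \<open>q\<close>.\<close>

lemma finite_good_approximations_pi_imp_pos:
  assumes "finite (good_approximations pi m)"
  shows "m > 0"
proof (rule ccontr)
  assume m: "\<not> m > 0"
  have "(\<lambda>q. (3 * q + 1, q)) ` {2..} \<subseteq> good_approximations pi m"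
  proof (rule image_subsetI)
    fix q :: nat assume "q \<in> {2..}"
    then have q: "real q \<ge> 2" "q > 0" by auto
    have "coprime (3 * q + 1) q" by (rule coprimeI) (metis dvd_add_right_iff dvd_mult)
    moreover have "pi \<noteq> real (3 * q + 1) / real q" using pi_neq_rational[of "3 * q + 1" q] q by simp
    moreover have "\<bar>pi - real (3 * q + 1) / real q\<bar> < 1 / real q powr m"
    proof -
      have "real (3 * q + 1) / real q = 3 + 1 / real q" using q by (simp add: field_simps)
      moreover have "1 / real q \<le> 1 / 2" using q by (simp add: field_simps)
      moreover have "1 / real q > 0" using q by simp
      ultimately have "\<bar>pi - real (3 * q + 1) / real q\<bar> < 1" using pi_gt3 pi_less_4 by linarith
      also have "real q powr m \<le> real q powr 0" using m q by (intro powr_mono) auto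
      then have "1 \<le> 1 / real q powr m" using q by simp
      finally show ?thesis .
    qed
    ultimately show "(3 * q + 1, q) \<in> good_approximations pi m"
      using q unfolding good_approximations_def by (simp del: of_nat_mult of_nat_add of_nat_Suc)
  qed
  with assms have "finite ((\<lambda>q::nat. (3 * q + 1, q)) ` {2..})" by (rule rev_finite_subset)
  then have "finite {2::nat..}" by (rule finite_imageD) (auto intro: inj_onI)
  then show False by (simp add: infinite_Ici)
qed

text \<open>The finitely many exceptions are absorbed into \<open>C\<close>, and
  \<open>C \<le> 1\<close> covers all other reduced fractions. Reducing a fraction shrinks its
  denominator, which for \<open>m > 0\<close> only strengthens the bound.\<close>

lemma finite_good_approximations_pi_imp_bound:
  assumes fin: "finite (good_approximations pi m)"
  obtains C where "C > 0"
    "\<And>p q :: nat. p > 0 \<Longrightarrow> q > 0 \<Longrightarrow> C / real q powr m \<le> \<bar>pi - real p / real q\<bar>"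
proof -
  have m: "m > 0" by (rule finite_good_approximations_pi_imp_pos[OF fin])
  define T where "T = insert 1 ((\<lambda>(p, q). \<bar>pi - real p / real q\<bar>) ` good_approximations pi m)"
  define C where "C = Min T"
  have T: "finite T" "T \<noteq> {}" using fin by (auto simp: T_def)
  have "C \<in> T" unfolding C_def by (rule Min_in[OF T])
  then have C0: "C > 0" by (auto simp: T_def good_approximations_def)
  have C1: "C \<le> 1" unfolding C_def by (rule Min_le[OF T(1)]) (simp add: T_def)
  have "C / real q powr m \<le> \<bar>pi - real p / real q\<bar>" if pq: "p > 0" "q > 0" for p q :: nat
  proof -
    obtain p' q' d where d: "p = p' * d" "q = q' * d" "coprime p' q'" "d > 0"
      using gcd_coprime_exists[of p q] pq by auto
    have pq': "p' > 0" "q' > 0" using d pq by auto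
    have eq: "real p / real q = real p' / real q'" using d by simp
    have qpos: "real q powr m > 0" using pq by simp
    have "real q' \<le> real q" unfolding of_nat_le_iff using d by simp
    then have mono: "real q' powr m \<le> real q powr m" using m by (intro powr_mono2) auto
    show ?thesis
    proof (cases "(p', q') \<in> good_approximations pi m")
      case True
      then have "C \<le> \<bar>pi - real p' / real q'\<bar>"
        unfolding C_def by (intro Min_le[OF T(1)]) (force simp: T_def)
      moreover have "1 \<le> real q powr m" using pq m by (simp add: ge_one_powr_ge_zero)
      then have "C / real q powr m \<le> C / 1" using C0 pq by (intro divide_left_mono) auto
      ultimately show ?thesis unfolding eq by simp
    next
      case False
      then have "1 / real q' powr m \<le> \<bar>pi - real p' / real q'\<bar>"
        using d(3) pq' pi_neq_rational[OF pq'] by (auto simp: good_approximations_def)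
      moreover have "C / real q powr m \<le> 1 / real q' powr m"
        using C1 C0 mono pq' by (intro frac_le) auto
      ultimately show ?thesis unfolding eq by linarith
    qed
  qed
  with C0 show ?thesis by (rule that)
qed

section \<open>The sine at integers and the distance to multiples of pi\<close>

lemma abs_sin_ge_third:
  fixes x :: real
  assumes "\<bar>x\<bar> \<le> 2"
  shows "\<bar>x\<bar> / 3 \<le> \<bar>sin x\<bar>"
proof -
  have "\<bar>sin x - x\<bar> \<le> \<bar>x\<bar> ^ 3 / 6"
    using Maclaurin_sin_bound[of x 3] by (simp add: numeral_3_eq_3 sin_coeff_def fact_numeral)
  also have "\<bar>x\<bar> ^ 3 \<le> \<bar>x\<bar> * 4"
  proof -
    have "\<bar>x\<bar> ^ 2 \<le> 2 ^ 2" using assms by (intro power_mono) auto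
    then have "\<bar>x\<bar> * \<bar>x\<bar> ^ 2 \<le> \<bar>x\<bar> * 4" by (intro mult_left_mono) auto
    then show ?thesis by (simp add: power3_eq_cube power2_eq_square)
  qed
  finally show ?thesis by linarith
qed

lemma sin_minus_int_mult_pi: "\<bar>sin (x - of_int k * pi)\<bar> = \<bar>sin x\<bar>"
proof -
  have "sin (of_int k * pi) = 0" by (auto simp: sin_zero_iff_int2)
  moreover from this have "\<bar>cos (of_int k * pi)\<bar> = 1"
    by (metis sin_zero_abs_cos_one)
  ultimately show ?thesis by (simp add: sin_diff abs_mult)
qed

lemma abs_sin_nat_lower_bound:
  assumes fin: "finite (good_approximations pi m)"
  obtains K where "K > 0" "\<And>n :: nat. n \<ge> 4 \<Longrightarrow> K * real n powr (1 - m) \<le> \<bar>sin (real n)\<bar>"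
proof -
  obtain C where C: "C > 0"
    "\<And>p q :: nat. p > 0 \<Longrightarrow> q > 0 \<Longrightarrow> C / real q powr m \<le> \<bar>pi - real p / real q\<bar>"
    using finite_good_approximations_pi_imp_bound[OF fin] by blast
  \<comment> \<open>The multiple \<open>q\<close> of pi nearest to \<open>n\<close> satisfies
    \<open>n / 8 \<le> q \<le> n\<close>; \<open>R\<close> allows for both signs of
    \<open>1 - m\<close> when \<open>q\<close> is replaced by \<open>n\<close>.\<close>
  define R where "R = min 1 ((1 / 8) powr (1 - m))"
  have R: "R > 0" by (simp add: R_def)
  have "C * R / 3 * real n powr (1 - m) \<le> \<bar>sin (real n)\<bar>" if n: "n \<ge> 4" for n :: nat
  proof -
    define k where "k = round (real n / pi)"
    have k: "\<bar>of_int k - real n / pi\<bar> \<le> 1 / 2" unfolding k_def by (rule of_int_round_abs_le)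
    have n': "real n \<ge> 4" using n by simp
    have npi: "real n / pi > 1" "real n / pi \<le> real n / 3" "real n / pi \<ge> real n / 4"
      using n' pi_gt3 pi_less_4 by (auto simp: field_simps)
    have "k \<ge> 1" using k npi by linarith
    then obtain q :: nat where q: "k = int q" "q \<ge> 1" by (metis nat_0_le nat_le_iff of_nat_1 of_nat_le_iff order.trans zero_le_one)
    have qn: "real q \<le> real n" "real n / 8 \<le> real q" using k npi n' unfolding q(1) of_int_of_nat_eq abs_le_iff by linarith+
    have "real n - of_int k * pi = - (of_int k - real n / pi) * pi" by (simp add: field_simps)
    then have "\<bar>real n - of_int k * pi\<bar> = \<bar>of_int k - real n / pi\<bar> * pi" by (simp add: abs_mult)
    also have "\<dots> \<le> 1 / 2 * pi" by (intro mult_right_mono k) auto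
    finally have small: "\<bar>real n - of_int k * pi\<bar> \<le> 2" using pi_less_4 by linarith
    have "R * real n powr (1 - m) \<le> real q powr (1 - m)"
    proof (cases "m \<le> 1")
      case True
      have "R * real n powr (1 - m) \<le> (1 / 8) powr (1 - m) * real n powr (1 - m)"
        by (intro mult_right_mono) (auto simp: R_def)
      also have "\<dots> = (real n / 8) powr (1 - m)" by (simp flip: powr_mult)
      also have "\<dots> \<le> real q powr (1 - m)" using True qn n' by (intro powr_mono2) auto
      finally show ?thesis .
    next
      case False
      have "R * real n powr (1 - m) \<le> 1 * real n powr (1 - m)"
        by (intro mult_right_mono) (auto simp: R_def)
      also have "\<dots> \<le> 1 * real q powr (1 - m)"
        using False qn q(2) by (intro mult_left_mono powr_mono2') auto
      finally show ?thesis by simp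
    qed
    then have "C * R * real n powr (1 - m) \<le> C * real q powr (1 - m)"
      using C(1) by (simp add: mult.assoc)
    also have "\<dots> = real q * (C / real q powr m)" using q by (simp add: powr_diff)
    also have "\<dots> \<le> real q * \<bar>pi - real n / real q\<bar>" using n q by (intro mult_left_mono C(2)) auto
    also have "\<dots> = \<bar>real q * (pi - real n / real q)\<bar>" by (simp add: abs_mult)
    also have "real q * (pi - real n / real q) = - (real n - of_int k * pi)" using q by (simp add: field_simps)
    finally have "C * R * real n powr (1 - m) \<le> \<bar>real n - of_int k * pi\<bar>" by simp
    also have "\<dots> \<le> 3 * \<bar>sin (real n)\<bar>"
      using abs_sin_ge_third[OF small] by (simp add: sin_minus_int_mult_pi)
    finally show ?thesis by simp
  qed
  then show ?thesis using that[of "C * R / 3"] C R by simp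
qed

lemma sin_seq_upper_bound:
  assumes fin: "finite (good_approximations pi m)" and "v > 0"
  obtains K where "K > 0" "\<And>n :: nat. n \<ge> 4 \<Longrightarrow> sin_seq u v n \<le> K * real n powr ((m - 1) * v - u)"
proof -
  obtain K where K: "K > 0" "\<And>n :: nat. n \<ge> 4 \<Longrightarrow> K * real n powr (1 - m) \<le> \<bar>sin (real n)\<bar>"
    using abs_sin_nat_lower_bound[OF fin] by blast
  have "sin_seq u v n \<le> 1 / K powr v * real n powr ((m - 1) * v - u)" if n: "n \<ge> 4" for n
  proof -
    have n0: "real n > 0" using n by simp
    have "(K * real n powr (1 - m)) powr v \<le> \<bar>sin (real n)\<bar> powr v"
      using K n \<open>v > 0\<close> by (intro powr_mono2) auto
    then have "sin_seq u v n \<le> 1 / (real n powr u * (K * real n powr (1 - m)) powr v)"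
      unfolding sin_seq_def using n0 K(1) by (intro divide_left_mono mult_left_mono mult_pos_pos) auto
    also have "\<dots> = 1 / K powr v * (1 / (real n powr u * real n powr ((1 - m) * v)))"
      using K(1) by (simp add: powr_mult powr_powr)
    also have "1 / (real n powr u * real n powr ((1 - m) * v)) = real n powr ((m - 1) * v - u)"
      using n0 by (simp add: powr_minus_divide[symmetric] flip: powr_add) (simp add: algebra_simps)
    finally show ?thesis .
  qed
  then show ?thesis using that[of "1 / K powr v"] K(1) by simp
qed

lemma sin_nat_nonzero: "n > 0 \<Longrightarrow> sin (real n) \<noteq> 0"
proof
  assume n: "n > 0" "sin (real n) = 0"
  then obtain i :: int where i: "real n = of_int i * pi" by (auto simp: sin_zero_iff_int2)
  have "of_int i * pi > 0" using i n by simp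
  then have "i > 0" by (simp add: zero_less_mult_iff)
  then obtain q :: nat where q: "i = int q" "q > 0" by (metis of_nat_0_less_iff zero_less_imp_eq_int)
  then have "pi = real n / real q" using i by (simp add: field_simps)
  then show False using pi_neq_rational n(1) q(2) by blast
qed

text \<open>A good approximation puts \<open>p\<close> within \<open>q powr (1 - m)\<close> of
  \<open>q * pi\<close>, which bounds the sine from above. As \<open>1 - m < 0\<close>, the
  inequality \<open>p / 5 \<le> q\<close> lets \<open>p\<close> replace \<open>q\<close>.\<close>

lemma sin_seq_lower_bound:
  assumes "(p, q) \<in> good_approximations pi m" "m > 1" "v > 0"
  shows "5 powr ((1 - m) * v) * real p powr ((m - 1) * v - u) \<le> sin_seq u v p"
proof -
  have pq: "p > 0" "q > 0" and d: "\<bar>pi - real p / real q\<bar> < 1 / real q powr m"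
    using assms by (auto simp: good_approximations_def)
  have "1 \<le> real q powr m" using pq assms by (simp add: ge_one_powr_ge_zero)
  then have "1 / real q powr m \<le> 1" using pq by (simp only: divide_le_eq_1) auto
  with d have "p < 5 * q" by (intro close_to_pi_imp_less(1)[OF pq(2)]) linarith
  then have p5: "real p / 5 \<le> real q" by simp
  have "\<bar>sin (real p)\<bar> = \<bar>sin (real p - of_int (int q) * pi)\<bar>" by (simp only: sin_minus_int_mult_pi)
  also have "\<dots> \<le> \<bar>real p - of_int (int q) * pi\<bar>" by (rule abs_sin_x_le_abs_x)
  also have "real p - of_int (int q) * pi = - (real q * (pi - real p / real q))" using pq by (simp add: field_simps)
  also have "\<bar>- (real q * (pi - real p / real q))\<bar> = real q * \<bar>pi - real p / real q\<bar>" by (simp add: abs_mult)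
  also have "\<dots> \<le> real q * (1 / real q powr m)" using d by (intro mult_left_mono) auto
  also have "\<dots> = real q powr (1 - m)" using pq by (simp add: powr_diff)
  also have "\<dots> \<le> (real p / 5) powr (1 - m)" using assms p5 pq by (intro powr_mono2') auto
  finally have "\<bar>sin (real p)\<bar> powr v \<le> ((real p / 5) powr (1 - m)) powr v"
    using assms by (intro powr_mono2) auto
  also have "\<dots> = real p powr ((1 - m) * v) / 5 powr ((1 - m) * v)" by (simp add: powr_powr powr_divide)
  finally have s: "\<bar>sin (real p)\<bar> powr v \<le> real p powr ((1 - m) * v) / 5 powr ((1 - m) * v)" .
  have "5 powr ((1 - m) * v) * real p powr ((m - 1) * v - u)
    = 1 / (real p powr u * (real p powr ((1 - m) * v) / 5 powr ((1 - m) * v)))"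
  proof -
    have "(m - 1) * v - u = - (u + (1 - m) * v)" by (simp add: algebra_simps)
    then show ?thesis by (simp only: powr_minus powr_add) (simp add: field_simps)
  qed
  also have "\<dots> \<le> sin_seq u v p"
    unfolding sin_seq_def using s pq sin_nat_nonzero[OF pq(1)]
    by (intro divide_left_mono mult_left_mono mult_pos_pos) auto
  finally show ?thesis .
qed

text \<open>Closeness to pi gives \<open>q < p\<close>, so each numerator occurs with finitely many
  denominators. Divergence needs arbitrarily large numerators.\<close>

lemma infinite_fst_good_approximations_pi:
  assumes "infinite (good_approximations pi m)" "m \<ge> 0"
  shows "infinite (fst ` good_approximations pi m)"
proof
  assume fin: "finite (fst ` good_approximations pi m)"
  have "good_approximations pi m \<subseteq> Sigma (fst ` good_approximations pi m) (\<lambda>p. {..p})"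
  proof clarify
    fix p q assume pq: "(p, q) \<in> good_approximations pi m"
    then have q: "q > 0" and d: "\<bar>pi - real p / real q\<bar> < 1 / real q powr m"
      by (auto simp: good_approximations_def)
    have "1 \<le> real q powr m" using q assms by (simp add: ge_one_powr_ge_zero)
    then have "1 / real q powr m \<le> 1" using q by (simp only: divide_le_eq_1) auto
    with d have "q < p" by (intro close_to_pi_imp_less(2)[OF q]) linarith
    then show "p \<in> fst ` good_approximations pi m \<and> q \<in> {..p}" using pq by force
  qed
  then have "finite (good_approximations pi m)" by (rule finite_subset) (use fin in auto)
  with assms(1) show False by simp
qed

text \<open>Along the numerators of good approximations the sequence exceeds a multiple of a
  positive power of \<open>p\<close>, so it is unbounded.\<close>

lemma sin_seq_not_convergent:
  assumes inf: "infinite (good_approximations pi m)" and m: "m > 1 + u / v" and uv: "u > 0" "v > 0"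
  shows "\<not> convergent (sin_seq u v)"
proof
  assume "convergent (sin_seq u v)"
  then obtain B where B: "\<And>n. \<bar>sin_seq u v n\<bar> \<le> B"
    by (metis convergent_imp_Bseq Bseq_def real_norm_def)
  have "u / v > 0" using uv by simp
  then have m1: "m > 1" using m by linarith
  have e: "(m - 1) * v - u > 0" using m uv by (simp add: field_simps)
  have "(\<lambda>n. B / 5 powr ((1 - m) * v) * real n powr (- ((m - 1) * v - u))) \<longlonglongrightarrow> 0"
    using e by (intro tendsto_mult_right_zero tendsto_neg_powr filterlim_real_sequentially) simp
  then have "eventually (\<lambda>n. B / 5 powr ((1 - m) * v) * real n powr (- ((m - 1) * v - u)) < 1) sequentially"
    by (rule order_tendstoD) simp
  then obtain N where N: "\<And>n. n \<ge> N \<Longrightarrow> B / 5 powr ((1 - m) * v) * real n powr (- ((m - 1) * v - u)) < 1"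
    by (auto simp: eventually_sequentially)
  obtain p where p: "p \<in> fst ` good_approximations pi m" "p \<ge> N"
    using infinite_fst_good_approximations_pi[OF inf] m1
    by (metis infinite_nat_iff_unbounded_le less_imp_le order.trans zero_le_one)
  then obtain q where pq: "(p, q) \<in> good_approximations pi m" by auto
  have "B < 5 powr ((1 - m) * v) * real p powr ((m - 1) * v - u)"
  proof -
    have "real p powr ((m - 1) * v - u) > 0" using pq by (simp add: good_approximations_def)
    moreover have "B / 5 powr ((1 - m) * v) / real p powr ((m - 1) * v - u) < 1"
      using N[OF p(2)] by (simp only: powr_minus_divide times_divide_eq_right mult_1_right)
    ultimately show ?thesis by (simp add: pos_divide_less_eq mult.commute)
  qed
  also have "\<dots> \<le> sin_seq u v p" by (rule sin_seq_lower_bound[OF pq m1 uv(2)])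
  also have "\<dots> \<le> B" using B[of p] by simp
  finally show False by simp
qed

lemma sin_seq_nonneg: "sin_seq u v n \<ge> 0"
  by (simp add: sin_seq_def)

lemma irrationality_measure_pi_finite: "\<bar>irrationality_measure pi\<bar> \<noteq> \<infinity>"
proof -
  obtain m where "finite (good_approximations pi m)" using finite_good_approximations_pi by blast
  then have "irrationality_measure pi \<le> ereal m"
    unfolding irrationality_measure_alt by (intro Inf_lower) auto
  moreover have "0 \<le> irrationality_measure pi"
    unfolding irrationality_measure_alt
    by (intro Inf_greatest) (auto dest: finite_good_approximations_pi_imp_pos)
  ultimately show ?thesis by auto
qed

theorem theorem2:
  fixes u v :: real
  assumes "u > 0" and "v > 0"
  shows "(\<forall>\<epsilon>::real. \<epsilon> > 0 \<longrightarrow>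
            sin_seq u v \<in> O(\<lambda>n. 1 / real n powr
              (u - (real_of_ereal (irrationality_measure pi) - 1) * v - \<epsilon>)))
       \<and> (irrationality_measure pi < ereal (1 + u / v) \<longrightarrow> sin_seq u v \<longlonglongrightarrow> 0)
       \<and> (irrationality_measure pi > ereal (1 + u / v) \<longrightarrow> \<not> convergent (sin_seq u v))"
proof (intro conjI allI impI)
  fix \<epsilon> :: real assume \<epsilon>: "\<epsilon> > 0"
  define \<mu> where "\<mu> = real_of_ereal (irrationality_measure pi)"
  have \<mu>: "irrationality_measure pi = ereal \<mu>"
    using irrationality_measure_pi_finite by (simp add: \<mu>_def ereal_real)
  \<comment> \<open>The exponent enters the estimate multiplied by \<open>v\<close>, so a slack of
    \<open>\<epsilon> / v\<close> in the measure costs exactly \<open>\<epsilon>\<close>.\<close>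
  also have "ereal \<mu> < ereal (\<mu> + \<epsilon> / v)" using \<epsilon> assms by simp
  finally obtain m where m: "finite (good_approximations pi m)" "m < \<mu> + \<epsilon> / v"
    unfolding irrationality_measure_alt Inf_less_iff by auto
  obtain K where K: "K > 0" "\<And>n :: nat. n \<ge> 4 \<Longrightarrow> sin_seq u v n \<le> K * real n powr ((m - 1) * v - u)"
    using sin_seq_upper_bound[OF m(1) assms(2)] by blast
  have "m * v < \<mu> * v + \<epsilon>" using m(2) assms by (simp add: field_simps)
  then have e: "(m - 1) * v - u \<le> - (u - (\<mu> - 1) * v - \<epsilon>)" by (simp add: algebra_simps)
  show "sin_seq u v \<in> O(\<lambda>n. 1 / real n powr (u - (real_of_ereal (irrationality_measure pi) - 1) * v - \<epsilon>))"
    unfolding \<mu>_def[symmetric]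
  proof (rule bigoI[where c = K], rule eventually_sequentiallyI[of 4])
    fix n :: nat assume n: "n \<ge> 4"
    have "sin_seq u v n \<le> K * real n powr ((m - 1) * v - u)" by (rule K(2)[OF n])
    also have "\<dots> \<le> K * real n powr (- (u - (\<mu> - 1) * v - \<epsilon>))"
      using n K(1) by (intro mult_left_mono powr_mono e) auto
    also have "\<dots> = K * (1 / real n powr (u - (\<mu> - 1) * v - \<epsilon>))"
      by (simp only: powr_minus_divide)
    finally show "norm (sin_seq u v n) \<le> K * norm (1 / real n powr (u - (\<mu> - 1) * v - \<epsilon>))"
      by (simp add: sin_seq_nonneg)
  qed
next
  assume "irrationality_measure pi < ereal (1 + u / v)"
  then obtain m where m: "finite (good_approximations pi m)" "m < 1 + u / v"
    unfolding irrationality_measure_alt Inf_less_iff by auto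
  obtain K where K: "K > 0" "\<And>n :: nat. n \<ge> 4 \<Longrightarrow> sin_seq u v n \<le> K * real n powr ((m - 1) * v - u)"
    using sin_seq_upper_bound[OF m(1) assms(2)] by blast
  have e: "(m - 1) * v - u < 0" using m(2) assms by (simp add: field_simps)
  have "(\<lambda>n. real n powr ((m - 1) * v - u)) \<longlonglongrightarrow> 0"
    by (rule tendsto_neg_powr[OF e filterlim_real_sequentially])
  then have lim: "(\<lambda>n. K * real n powr ((m - 1) * v - u)) \<longlonglongrightarrow> 0" by (rule tendsto_mult_right_zero)
  show "sin_seq u v \<longlonglongrightarrow> 0"
    by (rule tendsto_sandwich[OF _ _ tendsto_const lim])
       (use K(2) sin_seq_nonneg in \<open>auto intro: eventually_sequentiallyI[of 4]\<close>)
next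
  assume "irrationality_measure pi > ereal (1 + u / v)"
  then obtain m where m: "ereal (1 + u / v) < ereal m" "ereal m < irrationality_measure pi"
    using ereal_dense2 by blast
  have "infinite (good_approximations pi m)"
  proof
    assume "finite (good_approximations pi m)"
    then have "irrationality_measure pi \<le> ereal m"
      unfolding irrationality_measure_alt by (intro Inf_lower) auto
    with m(2) show False by simp
  qed
  then show "\<not> convergent (sin_seq u v)"
    using sin_seq_not_convergent m(1) assms by simp
qed

end
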